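(* Let $\mathcal{B}$ be the canonical basis of 2-roots in type $Y_{a,b,c}$ ($a,b,c\ge1$), let $X$ be a $W$-orbit of real 2-roots, let $F$ be an arbitrary field, let $N=F(\mathcal{B}\cap X)$, and assume the restriction of the bilinear form $B'$ to $N$ is nonzero. (i) The radical $\mathrm{rad}(N)$ of $N$ (with respect to $B'$) is the unique maximal $FW$-submodule of $N$. (ii) The module $N/\mathrm{rad}(N)$ is an irreducible $FW$-module. (iii) The module $N$ is indecomposable, and is irreducible if and only if $\mathrm{rad}(N)=0$.
   Context: $Y_{a,b,c}$ ($a,b,c\ge1$) is the tree with $n=a+b+c+1$ vertices consisting of three paths with $a$, $b$ and $c$ vertices, each joined by one of its endpoints to a common trivalent branch vertex. Its Cartan matrix $A$ has $A_{ii}=2$, $A_{ij}=-1$ if $i,j$ are adjacent, and $A_{ij}=0$ otherwise. $W$ is the group generated by $s_1,\dots,s_n$ subject to $s_i^2=1$, $s_is_j=s_js_i$ if $A_{ij}=0$, and $s_is_js_i=s_js_is_j$ if $A_{ij}=-1$. $V$ is the real vector space with basis the simple roots $\Pi=\{\alpha_1,\dots,\alpha_n\}$, with symmetric bilinear form $B(\alpha_i,\alpha_j)=A_{ij}$, on which $W$ acts by $s_i(v)=v-B(\alpha_i,v)\alpha_i$. A real root is a vector $w(\alpha_i)$ with $w\in W$. For $\alpha,\beta\in V$, $\alpha\vee\beta=\alpha\otimes\beta+\beta\otimes\alpha$; $S^2(V)\subseteq V\otimes V$ is the span of these elements, with the diagonal $W$-action. A real 2-root is $\alpha\vee\beta$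 with $\alpha,\beta$ real roots such that $B(\alpha,\beta)=0$; $W$ permutes the real 2-roots. Canonical basis. The highest root of a type $D_m$ ($m\ge4$) root system is the sum of the simple roots with coefficient $1$ at the endpoints of the diagram and $2$ at all other vertices. For a simple root $\alpha_i$, a positive root $\beta$ is elementary with respect to $\alpha_i$ if: (1) $\beta=\alpha_j$ is simple with $A_{ij}=0$; (2) $\beta=\alpha_h+\alpha_i+\alpha_j$ for a path $h$--$i$--$j$ in $Y_{a,b,c}$; or (3) $i$ is not the branch vertex and $\beta=\theta_i$ is the highest root of the standard parabolic subsystem of type $D_m$ ($m\ge 4$) whose simple roots are those on the path from $i$ to the branch vertex together with all neighbours of the branch vertex. $\mathcal{B}$ is the set of all $\alpha_i\vee\beta$ with $\alpha_i\in\Pi$ and $\beta$ elementary with respect to $\alpha_i$; its elements are linearly independent real 2-roots. The $\mathbb{Z}$-span $\mathbb{Z}\mathcal{B}$ and, for each $W$-orbit $X$ of real 2-roots, $\mathbb{Z}(\mathcal{B}\cap X)$ are stable under $W$. Put $F\mathcal{B}=F\otimes_{\mathbb{Z}}\mathbb{Z}\mathcal{B}$ and $F(\mathcal{B}\cap X)=F\otimes_{\mathbb{Z}}\mathbb{Z}(\mathcal{B}\cap X)$, which are $FW$-modules. $B'$ is the $W$-invariant symmetric bilinear form on $S^2(V)$ with $B'(\alpha_i\vee\alpha_j,\alpha_k\vee\alpha_l)=B(\alpha_i,\alpha_k)B(\alpha_j,\alpha_l)+B(\alpha_i,\alpha_l)B(\alpha_j,\alpha_k)$; it is integer-valued on $\mathbb{Z}\mathcal{B}$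 and hence induces an $F$-valued bilinear form, also denoted $B'$, on $F\mathcal{B}$. For a submodule $N$ of $F\mathcal{B}$, $\mathrm{rad}(N)=\{v\in N: B'(v,v')=0\text{ for all }v'\in N\}$. *)

theory Defs
  imports
    Complex_Main
    "HOL-Library.Function_Algebras"
    "HOL-Computational_Algebra.Group_Closure"
    "HOL-Algebra.Module"
    "HOL-Algebra.AbelCoset"
    "HOL-Algebra.Group_Action"
    "HOL-Algebra.Free_Abelian_Groups"
begin

section \<open>The diagram and its Cartan matrix\<close>

datatype arm = First | Second | Third

text \<open>\<open>Arm k m\<close> is the vertex of arm \<open>k\<close> at distance \<open>m + 1\<close> from the branch vertex.\<close>

datatype vertex = Branch | Arm arm nat

fun arm_size :: "nat \<Rightarrow> nat \<Rightarrow> nat \<Rightarrow> arm \<Rightarrow> nat" where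
  "arm_size a b c First = a"
| "arm_size a b c Second = b"
| "arm_size a b c Third = c"

definition Y_diagram :: "nat \<Rightarrow> nat \<Rightarrow> nat \<Rightarrow> vertex set" where
  "Y_diagram a b c = insert Branch {Arm k m | k m. m < arm_size a b c k}"

text \<open>Adjacency in \<open>Y_diagram a b c\<close> is the restriction of the following relation, so the vertex
  set \<open>I\<close> is the only parameter of the constructions below.\<close>

fun adjacent :: "vertex \<Rightarrow> vertex \<Rightarrow> bool" where
  "adjacent Branch Branch = False"
| "adjacent Branch (Arm k m) = (m = 0)"
| "adjacent (Arm k m) Branch = (m = 0)"
| "adjacent (Arm k m) (Arm l p) = (k = l \<and> (p = Suc m \<or> m = Suc p))"

definition cartan :: "vertex \<Rightarrow> vertex \<Rightarrow> int" where
  "cartan i j = (if i = j then 2 else if adjacent i j then - 1 else 0)"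

section \<open>The Coxeter group by generators and relations\<close>

text \<open>Because the generators are involutions, the monoid with this presentation is the group with
  this presentation; elements are congruence classes of words in \<open>I\<close>.\<close>

inductive coxeter_eq :: "vertex set \<Rightarrow> vertex list \<Rightarrow> vertex list \<Rightarrow> bool" for I where
  refl: "u \<in> lists I \<Longrightarrow> coxeter_eq I u u"
| sym: "coxeter_eq I u v \<Longrightarrow> coxeter_eq I v u"
| trans: "coxeter_eq I u v \<Longrightarrow> coxeter_eq I v w \<Longrightarrow> coxeter_eq I u w"
| append: "coxeter_eq I u u' \<Longrightarrow> coxeter_eq I v v' \<Longrightarrow> coxeter_eq I (u @ v) (u' @ v')"
| square: "i \<in> I \<Longrightarrow> coxeter_eq I [i, i] []"
| commute: "i \<in> I \<Longrightarrow> j \<in> I \<Longrightarrow> cartan i j = 0 \<Longrightarrow> coxeter_eq I [i, j] [j, i]"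
| braid: "i \<in> I \<Longrightarrow> j \<in> I \<Longrightarrow> cartan i j = - 1 \<Longrightarrow> coxeter_eq I [i, j, i] [j, i, j]"

definition coxeter_rel :: "vertex set \<Rightarrow> (vertex list \<times> vertex list) set" where
  "coxeter_rel I = {(u, v). coxeter_eq I u v}"

definition coxeter_group :: "vertex set \<Rightarrow> vertex list set monoid" where
  "coxeter_group I =
    \<lparr>carrier = lists I // coxeter_rel I,
     mult = (\<lambda>x y. \<Union>u\<in>x. \<Union>v\<in>y. coxeter_rel I `` {u @ v}),
     one = coxeter_rel I `` {[]}\<rparr>"

lemma coxeter_eq_lists: "coxeter_eq I u v \<Longrightarrow> u \<in> lists I \<and> v \<in> lists I"
  by (induction rule: coxeter_eq.induct) auto

lemma equiv_coxeter_rel: "equiv (lists I) (coxeter_rel I)"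
  unfolding coxeter_rel_def
proof (rule equivI)
  show "{(u, v). coxeter_eq I u v} \<subseteq> lists I \<times> lists I"
    using coxeter_eq_lists by blast
qed (auto intro!: refl_onI symI transI intro: coxeter_eq.intros)

lemma coxeter_mult_class:
  assumes "u \<in> lists I" "v \<in> lists I"
  shows "coxeter_rel I `` {u} \<otimes>\<^bsub>coxeter_group I\<^esub> coxeter_rel I `` {v} = coxeter_rel I `` {u @ v}"
proof -
  have *: "coxeter_rel I `` {u' @ v'} = coxeter_rel I `` {u @ v}"
    if "coxeter_eq I u u'" "coxeter_eq I v v'" for u' v'
    by (rule equiv_class_eq[OF equiv_coxeter_rel])
      (use that in \<open>auto simp: coxeter_rel_def intro: coxeter_eq.intros\<close>)
  have "coxeter_rel I `` {u} \<otimes>\<^bsub>coxeter_group I\<^esub> coxeter_rel I `` {v}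
      = (\<Union>u'\<in>coxeter_rel I `` {u}. \<Union>v'\<in>coxeter_rel I `` {v}. coxeter_rel I `` {u' @ v'})"
    by (simp add: coxeter_group_def)
  also have "\<dots> = (\<Union>u'\<in>coxeter_rel I `` {u}. \<Union>v'\<in>coxeter_rel I `` {v}. coxeter_rel I `` {u @ v})"
    by (intro SUP_cong HOL.refl *) (simp_all add: coxeter_rel_def)
  also have "\<dots> = coxeter_rel I `` {u @ v}"
  proof -
    have "u \<in> coxeter_rel I `` {u}" "v \<in> coxeter_rel I `` {v}"
      using assms by (simp_all add: coxeter_rel_def coxeter_eq.refl)
    then show ?thesis
      by blast
  qed
  finally show ?thesis .
qed

lemma coxeter_eq_rev: "u \<in> lists I \<Longrightarrow> coxeter_eq I (rev u @ u) []"
proof (induction u)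
  case (Cons i u)
  have "coxeter_eq I ((rev u @ [i, i]) @ u) ((rev u @ []) @ u)"
    using Cons.prems by (intro coxeter_eq.append coxeter_eq.refl coxeter_eq.square) auto
  then show ?case
    using Cons by (auto intro: coxeter_eq.trans)
qed (auto intro: coxeter_eq.refl)

lemma coxeter_group_cases:
  assumes "x \<in> carrier (coxeter_group I)"
  obtains u where "u \<in> lists I" "x = coxeter_rel I `` {u}"
  using assms that by (auto simp: coxeter_group_def quotient_def)

lemma coxeter_class_in_carrier: "u \<in> lists I \<Longrightarrow> coxeter_rel I `` {u} \<in> carrier (coxeter_group I)"
  by (simp add: coxeter_group_def quotientI)

lemma coxeter_group_one: "\<one>\<^bsub>coxeter_group I\<^esub> = coxeter_rel I `` {[]}"
  by (simp add: coxeter_group_def)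

lemma group_coxeter_group: "group (coxeter_group I)"
proof (rule groupI)
  show "\<one>\<^bsub>coxeter_group I\<^esub> \<in> carrier (coxeter_group I)"
    by (simp add: coxeter_group_one coxeter_class_in_carrier)
next
  fix x y assume "x \<in> carrier (coxeter_group I)" "y \<in> carrier (coxeter_group I)"
  then show "x \<otimes>\<^bsub>coxeter_group I\<^esub> y \<in> carrier (coxeter_group I)"
    by (elim coxeter_group_cases) (simp add: coxeter_mult_class coxeter_class_in_carrier)
next
  fix x y z
  assume "x \<in> carrier (coxeter_group I)" "y \<in> carrier (coxeter_group I)"
    "z \<in> carrier (coxeter_group I)"
  then show "x \<otimes>\<^bsub>coxeter_group I\<^esub> y \<otimes>\<^bsub>coxeter_group I\<^esub> z = x \<otimes>\<^bsub>coxeter_group I\<^esub> (y \<otimes>\<^bsub>coxeter_group I\<^esub> z)"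
    by (elim coxeter_group_cases) (simp add: coxeter_mult_class)
next
  fix x assume "x \<in> carrier (coxeter_group I)"
  then show "\<one>\<^bsub>coxeter_group I\<^esub> \<otimes>\<^bsub>coxeter_group I\<^esub> x = x"
    by (elim coxeter_group_cases) (simp add: coxeter_group_one coxeter_mult_class)
next
  fix x assume "x \<in> carrier (coxeter_group I)"
  then obtain u where u: "u \<in> lists I" "x = coxeter_rel I `` {u}"
    by (rule coxeter_group_cases)
  have rev: "rev u \<in> lists I"
    using u by auto
  have "coxeter_rel I `` {rev u @ u} = coxeter_rel I `` {[]}"
    by (rule equiv_class_eq[OF equiv_coxeter_rel])
      (use u coxeter_eq_rev in \<open>auto simp: coxeter_rel_def\<close>)
  then have "coxeter_rel I `` {rev u} \<otimes>\<^bsub>coxeter_group I\<^esub> x = \<one>\<^bsub>coxeter_group I\<^esub>"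
    by (simp only: coxeter_group_one u(2) coxeter_mult_class[OF rev u(1)])
  then show "\<exists>y\<in>carrier (coxeter_group I). y \<otimes>\<^bsub>coxeter_group I\<^esub> x = \<one>\<^bsub>coxeter_group I\<^esub>"
    by (rule rev_bexI[OF coxeter_class_in_carrier[OF rev]])
qed

section \<open>The reflection representation and real roots\<close>

text \<open>Vectors are coordinate functions with respect to the simple roots; \<open>V\<close> consists of those
  vanishing outside \<open>I\<close>, and all vectors constructed below do.\<close>

definition scale :: "real \<Rightarrow> ('i \<Rightarrow> real) \<Rightarrow> 'i \<Rightarrow> real" where
  "scale r v = (\<lambda>i. r * v i)"

definition simple_root :: "vertex \<Rightarrow> vertex \<Rightarrow> real" where
  "simple_root i = (\<lambda>j. if j = i then 1 else 0)"

definition bform :: "vertex set \<Rightarrow> (vertex \<Rightarrow> real) \<Rightarrow> (vertex \<Rightarrow> real) \<Rightarrow> real" where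
  "bform I u v = (\<Sum>i\<in>I. \<Sum>j\<in>I. u i * v j * of_int (cartan i j))"

definition reflection :: "vertex set \<Rightarrow> vertex \<Rightarrow> (vertex \<Rightarrow> real) \<Rightarrow> vertex \<Rightarrow> real" where
  "reflection I i v = v - scale (bform I (simple_root i) v) (simple_root i)"

definition word_act :: "vertex set \<Rightarrow> vertex list \<Rightarrow> (vertex \<Rightarrow> real) \<Rightarrow> vertex \<Rightarrow> real" where
  "word_act I = foldr (reflection I)"

text \<open>Independent of the representative word: see \<open>coxeter_act_class\<close>.\<close>

definition coxeter_act :: "vertex set \<Rightarrow> vertex list set \<Rightarrow> (vertex \<Rightarrow> real) \<Rightarrow> vertex \<Rightarrow> real" where
  "coxeter_act I w = word_act I (SOME u. u \<in> w)"

lemma finite_Y_diagram: "finite (Y_diagram a b c)"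
proof -
  have "x \<in> (\<Union>k\<in>{First, Second, Third}. Arm k ` {..<arm_size a b c k})"
    if "x \<in> {Arm k m | k m. m < arm_size a b c k}" for x
  proof -
    obtain k m where "x = Arm k m" "m < arm_size a b c k"
      using \<open>x \<in> _\<close> by blast
    then show ?thesis
      by (cases k) simp_all
  qed
  then have "{Arm k m | k m. m < arm_size a b c k}
      \<subseteq> (\<Union>k\<in>{First, Second, Third}. Arm k ` {..<arm_size a b c k})"
    by (rule subsetI)
  then show ?thesis
    unfolding Y_diagram_def by (simp add: finite_subset)
qed

lemma cartan_commute: "cartan i j = cartan j i"
  by (cases i; cases j) (auto simp: cartan_def)

lemma bform_simple_left:
  assumes "finite I" "i \<in> I"
  shows "bform I (simple_root i) v = (\<Sum>j\<in>I. v j * of_int (cartan i j))"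
proof -
  have "bform I (simple_root i) v = (\<Sum>k\<in>I. if k = i then \<Sum>j\<in>I. v j * of_int (cartan i j) else 0)"
    unfolding bform_def by (rule sum.cong) (auto simp: simple_root_def)
  then show ?thesis
    using assms by simp
qed

lemma bform_simple:
  "finite I \<Longrightarrow> i \<in> I \<Longrightarrow> j \<in> I \<Longrightarrow> bform I (simple_root i) (simple_root j) = of_int (cartan i j)"
  by (simp add: bform_simple_left) (simp add: simple_root_def if_distrib[of "\<lambda>x. x * _"] cong: if_cong)

lemma bform_diff_scale:
  "bform I u (v - scale r w) = bform I u v - r * bform I u w"
  by (simp add: bform_def scale_def sum_subtractf sum_distrib_left algebra_simps)

lemma reflection_apply:
  "reflection I i v x = v x - bform I (simple_root i) v * simple_root i x"
  by (simp add: reflection_def scale_def)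

lemma bform_simple_reflection:
  assumes "finite I" "i \<in> I" "j \<in> I"
  shows "bform I (simple_root i) (reflection I j v)
    = bform I (simple_root i) v - bform I (simple_root j) v * of_int (cartan i j)"
  using assms by (simp add: reflection_def bform_diff_scale bform_simple)

lemma word_act_coxeter_eq:
  assumes "finite I" "coxeter_eq I u v"
  shows "word_act I u = word_act I v"
  using assms(2)
proof (induction rule: coxeter_eq.induct)
  case (append u u' v v')
  then show ?case by (simp add: word_act_def)
next
  case (square i)
  have "cartan i i = 2" by (simp add: cartan_def)
  then show ?case
    using assms(1) square
    by (simp add: word_act_def fun_eq_iff reflection_apply bform_simple_reflection)
next
  case (commute i j)
  then have "cartan j i = 0" by (simp add: cartan_commute)
  then show ?case
    using assms(1) commute
    by (simp add: word_act_def fun_eq_iff reflection_apply bform_simple_reflection)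
next
  case (braid i j)
  then have "cartan j i = - 1" by (simp add: cartan_commute)
  moreover have "cartan i i = 2" "cartan j j = 2" by (simp_all add: cartan_def)
  ultimately show ?case
    using assms(1) braid
    by (simp add: word_act_def fun_eq_iff reflection_apply bform_simple_reflection algebra_simps)
qed auto

lemma coxeter_act_class:
  assumes "finite I" "u \<in> lists I"
  shows "coxeter_act I (coxeter_rel I `` {u}) = word_act I u"
proof -
  have "u \<in> coxeter_rel I `` {u}"
    using assms by (auto simp: coxeter_rel_def intro: coxeter_eq.refl)
  then have "(SOME v. v \<in> coxeter_rel I `` {u}) \<in> coxeter_rel I `` {u}"
    by (rule someI)
  then have "coxeter_eq I u (SOME v. v \<in> coxeter_rel I `` {u})"
    by (auto simp: coxeter_rel_def)
  then show ?thesis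
    unfolding coxeter_act_def using word_act_coxeter_eq[OF assms(1)] by metis
qed

definition real_roots :: "vertex set \<Rightarrow> (vertex \<Rightarrow> real) set" where
  "real_roots I =
    {coxeter_act I w (simple_root i) | w i. w \<in> carrier (coxeter_group I) \<and> i \<in> I}"

definition positive_roots :: "vertex set \<Rightarrow> (vertex \<Rightarrow> real) set" where
  "positive_roots I = {\<beta> \<in> real_roots I. \<forall>i. 0 \<le> \<beta> i}"

section \<open>Real 2-roots\<close>

text \<open>\<open>V \<otimes> V\<close> is coordinatised by the basis of tensors of two simple roots.\<close>

definition tensor :: "(vertex \<Rightarrow> real) \<Rightarrow> (vertex \<Rightarrow> real) \<Rightarrow> vertex \<times> vertex \<Rightarrow> real" where
  "tensor u v = (\<lambda>(i, j). u i * v j)"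

definition sym_tensor :: "(vertex \<Rightarrow> real) \<Rightarrow> (vertex \<Rightarrow> real) \<Rightarrow> vertex \<times> vertex \<Rightarrow> real"
    (infixl \<open>\<or>\<^sub>s\<close> 70) where
  "u \<or>\<^sub>s v = tensor u v + tensor v u"

definition tensor_act ::
    "vertex set \<Rightarrow> vertex list set \<Rightarrow> (vertex \<times> vertex \<Rightarrow> real) \<Rightarrow> vertex \<times> vertex \<Rightarrow> real" where
  "tensor_act I w t =
    (\<Sum>i\<in>I. \<Sum>j\<in>I. scale (t (i, j))
      (tensor (coxeter_act I w (simple_root i)) (coxeter_act I w (simple_root j))))"

definition real_2_roots :: "vertex set \<Rightarrow> (vertex \<times> vertex \<Rightarrow> real) set" where
  "real_2_roots I =
    {\<alpha> \<or>\<^sub>s \<beta> | \<alpha> \<beta>. \<alpha> \<in> real_roots I \<and> \<beta> \<in> real_roots I \<and> bform I \<alpha> \<beta> = 0}"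

text \<open>The form \<open>B'\<close> on symmetric tensors. On all of \<open>V \<otimes> V\<close> the form \<open>B \<otimes> B\<close> takes twice the
  required value on pairs \<open>\<alpha>\<^sub>i \<or> \<alpha>\<^sub>j\<close>, \<open>\<alpha>\<^sub>k \<or> \<alpha>\<^sub>l\<close>, whence the factor \<open>1/2\<close>; see \<open>bform2_simple\<close>.\<close>

definition bform2 ::
    "vertex set \<Rightarrow> (vertex \<times> vertex \<Rightarrow> real) \<Rightarrow> (vertex \<times> vertex \<Rightarrow> real) \<Rightarrow> real" where
  "bform2 I s t = 1/2 * (\<Sum>i\<in>I. \<Sum>j\<in>I. \<Sum>k\<in>I. \<Sum>l\<in>I.
    s (i, j) * t (k, l) * of_int (cartan i k) * of_int (cartan j l))"

lemma bform2_tensor: "bform2 I (tensor p q) (tensor r t) = 1/2 * (bform I p r * bform I q t)"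
proof -
  have "bform I p r * bform I q t = (\<Sum>i\<in>I. \<Sum>j\<in>I. \<Sum>k\<in>I. \<Sum>l\<in>I.
      (p i * r k * of_int (cartan i k)) * (q j * t l * of_int (cartan j l)))"
    unfolding bform_def sum_product by (rule HOL.refl)
  also have "\<dots> = (\<Sum>i\<in>I. \<Sum>j\<in>I. \<Sum>k\<in>I. \<Sum>l\<in>I.
      tensor p q (i, j) * tensor r t (k, l) * of_int (cartan i k) * of_int (cartan j l))"
    by (intro sum.cong HOL.refl) (simp add: tensor_def)
  finally show ?thesis
    by (simp only: bform2_def)
qed

lemma bform2_add_left: "bform2 I (s + s') t = bform2 I s t + bform2 I s' t"
  by (simp add: bform2_def distrib_right sum.distrib add_divide_distrib)

lemma bform2_add_right: "bform2 I s (t + t') = bform2 I s t + bform2 I s t'"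
  by (simp add: bform2_def distrib_left distrib_right sum.distrib add_divide_distrib)

lemma bform2_sym_tensor:
  "bform2 I (u \<or>\<^sub>s v) (x \<or>\<^sub>s y) = bform I u x * bform I v y + bform I u y * bform I v x"
  by (simp add: sym_tensor_def bform2_add_left bform2_add_right bform2_tensor)

lemma bform2_simple:
  assumes "finite I" "i \<in> I" "j \<in> I" "k \<in> I" "l \<in> I"
  shows "bform2 I (simple_root i \<or>\<^sub>s simple_root j) (simple_root k \<or>\<^sub>s simple_root l)
    = of_int (cartan i k) * of_int (cartan j l) + of_int (cartan i l) * of_int (cartan j k)"
  using assms by (simp add: bform2_sym_tensor bform_simple)

section \<open>The canonical basis\<close>

fun path_to_branch :: "vertex \<Rightarrow> vertex set" where
  "path_to_branch Branch = {Branch}"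
| "path_to_branch (Arm k m) = insert Branch (Arm k ` {..m})"

text \<open>For \<open>i \<noteq> Branch\<close> the subdiagram is of type \<open>D\<^sub>m\<close>, \<open>m \<ge> 4\<close>, and \<open>theta I i\<close> is its highest root;
  the endpoints are the vertices with exactly one neighbour in the subdiagram.\<close>

definition D_subdiagram :: "vertex set \<Rightarrow> vertex \<Rightarrow> vertex set" where
  "D_subdiagram I i = path_to_branch i \<union> {j \<in> I. adjacent Branch j}"

definition theta :: "vertex set \<Rightarrow> vertex \<Rightarrow> vertex \<Rightarrow> real" where
  "theta I i = (\<Sum>j\<in>D_subdiagram I i.
    scale (if card {h \<in> D_subdiagram I i. adjacent h j} = 1 then 1 else 2) (simple_root j))"

definition elementary :: "vertex set \<Rightarrow> vertex \<Rightarrow> (vertex \<Rightarrow> real) \<Rightarrow> bool" where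
  "elementary I i \<beta> \<longleftrightarrow> \<beta> \<in> positive_roots I \<and>
    ((\<exists>j\<in>I. cartan i j = 0 \<and> \<beta> = simple_root j)
     \<or> (\<exists>h\<in>I. \<exists>j\<in>I. h \<noteq> j \<and> adjacent h i \<and> adjacent i j
          \<and> \<beta> = simple_root h + simple_root i + simple_root j)
     \<or> (i \<noteq> Branch \<and> \<beta> = theta I i))"

definition canonical_basis :: "vertex set \<Rightarrow> (vertex \<times> vertex \<Rightarrow> real) set" where
  "canonical_basis I = {simple_root i \<or>\<^sub>s \<beta> | i \<beta>. i \<in> I \<and> elementary I i \<beta>}"

section \<open>Modules with a linear group action\<close>

text \<open>Modules over the group algebra \<open>FG\<close>, given as \<open>F\<close>-modules with an \<open>F\<close>-linear action of
  \<open>G\<close>. (The locale \<open>module\<close> is restricted to commutative rings, so it does not apply to \<open>FG\<close>.)\<close>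

locale group_module = Module.module F M + G?: group G
  for F (structure) and G (structure) and M (structure) and \<rho> +
  assumes act_closed: "g \<in> carrier G \<Longrightarrow> x \<in> carrier M \<Longrightarrow> \<rho> g x \<in> carrier M"
    and act_one: "x \<in> carrier M \<Longrightarrow> \<rho> \<one>\<^bsub>G\<^esub> x = x"
    and act_mult: "g \<in> carrier G \<Longrightarrow> h \<in> carrier G \<Longrightarrow> x \<in> carrier M \<Longrightarrow>
      \<rho> (g \<otimes>\<^bsub>G\<^esub> h) x = \<rho> g (\<rho> h x)"
    and act_add: "g \<in> carrier G \<Longrightarrow> x \<in> carrier M \<Longrightarrow> y \<in> carrier M \<Longrightarrow>
      \<rho> g (x \<oplus>\<^bsub>M\<^esub> y) = \<rho> g x \<oplus>\<^bsub>M\<^esub> \<rho> g y"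
    and act_smult: "g \<in> carrier G \<Longrightarrow> r \<in> carrier F \<Longrightarrow> x \<in> carrier M \<Longrightarrow>
      \<rho> g (r \<odot>\<^bsub>M\<^esub> x) = r \<odot>\<^bsub>M\<^esub> \<rho> g x"

definition group_submodule where
  "group_submodule F G M \<rho> H \<longleftrightarrow>
    submodule H F M \<and> (\<forall>g\<in>carrier G. \<forall>x\<in>H. \<rho> g x \<in> H)"

definition maximal_group_submodule where
  "maximal_group_submodule F G M \<rho> H \<longleftrightarrow>
    group_submodule F G M \<rho> H \<and> H \<noteq> carrier M \<and>
    (\<forall>K. group_submodule F G M \<rho> K \<and> H \<subseteq> K \<longrightarrow> K = H \<or> K = carrier M)"

definition irreducible_group_module where
  "irreducible_group_module F G M \<rho> \<longleftrightarrow>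
    group_module F G M \<rho> \<and> carrier M \<noteq> {\<zero>\<^bsub>M\<^esub>} \<and>
    (\<forall>K. group_submodule F G M \<rho> K \<longrightarrow> K = {\<zero>\<^bsub>M\<^esub>} \<or> K = carrier M)"

definition indecomposable_group_module where
  "indecomposable_group_module F G M \<rho> \<longleftrightarrow>
    group_module F G M \<rho> \<and> carrier M \<noteq> {\<zero>\<^bsub>M\<^esub>} \<and>
    \<not> (\<exists>U U'. group_submodule F G M \<rho> U \<and> group_submodule F G M \<rho> U' \<and>
        U \<noteq> {\<zero>\<^bsub>M\<^esub>} \<and> U' \<noteq> {\<zero>\<^bsub>M\<^esub>} \<and> U \<inter> U' = {\<zero>\<^bsub>M\<^esub>} \<and> U <+>\<^bsub>M\<^esub> U' = carrier M)"

text \<open>The map induced on cosets of \<open>H\<close> by an additive map \<open>f\<close> with \<open>f ` H \<subseteq> H\<close>. For such \<open>f\<close> all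
  the cosets in the union coincide.\<close>

definition coset_map where
  "coset_map M H f C = (\<Union>x\<in>C. H +>\<^bsub>M\<^esub> f x)"

text \<open>The ring multiplication fields of a \<open>module\<close> record play no role.\<close>

definition quotient_module where
  "quotient_module M H =
    \<lparr>carrier = a_rcosets\<^bsub>M\<^esub> H, mult = undefined, one = undefined,
     ring.zero = H, ring.add = (\<lambda>C D. C <+>\<^bsub>M\<^esub> D), smult = (\<lambda>r. coset_map M H (\<lambda>x. r \<odot>\<^bsub>M\<^esub> x))\<rparr>"

definition quotient_act where
  "quotient_act M H \<rho> g = coset_map M H (\<rho> g)"

section \<open>Extension of scalars\<close>

text \<open>\<open>F \<otimes>\<^sub>\<int> L\<close> for an additive subgroup \<open>L\<close>: the free abelian group on \<open>F \<times> L\<close> modulo biadditivity,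
  with scalars acting on the first factor. Before passing to the quotient the scalars do not satisfy
  \<open>(r + s) p = r p + s p\<close>, so \<open>formal_tensors\<close> itself is not an \<open>F\<close>-module.\<close>

definition formal_tensors ::
    "('f, 'r) ring_scheme \<Rightarrow> 'v set \<Rightarrow> ('f, ('f \<times> 'v) \<Rightarrow>\<^sub>0 int) module" where
  "formal_tensors F L =
    \<lparr>carrier = carrier (free_Abelian_group (carrier F \<times> L)), mult = undefined, one = undefined,
     ring.zero = 0, ring.add = (+), smult = (\<lambda>r. frag_extend (\<lambda>(f, x). frag_of (r \<otimes>\<^bsub>F\<^esub> f, x)))\<rparr>"

definition tensor_relations ::
    "('f, 'r) ring_scheme \<Rightarrow> 'v::ab_group_add set \<Rightarrow> (('f \<times> 'v) \<Rightarrow>\<^sub>0 int) set" where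
  "tensor_relations F L = group_closure
    ({frag_of (f \<oplus>\<^bsub>F\<^esub> g, x) - frag_of (f, x) - frag_of (g, x) | f g x.
        f \<in> carrier F \<and> g \<in> carrier F \<and> x \<in> L} \<union>
     {frag_of (f, x + y) - frag_of (f, x) - frag_of (f, y) | f x y.
        f \<in> carrier F \<and> x \<in> L \<and> y \<in> L})"

definition base_change ::
    "('f, 'r) ring_scheme \<Rightarrow> 'v::ab_group_add set \<Rightarrow> ('f, (('f \<times> 'v) \<Rightarrow>\<^sub>0 int) set) module" where
  "base_change F L = quotient_module (formal_tensors F L) (tensor_relations F L)"

definition base_change_act where
  "base_change_act F L \<rho> g = coset_map (formal_tensors F L) (tensor_relations F L)
    (frag_extend (\<lambda>(f, x). frag_of (f, \<rho> g x)))"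

text \<open>The \<open>F\<close>-bilinear form on \<open>F \<otimes>\<^sub>\<int> L\<close> induced by a biadditive form \<open>\<beta>\<close> on \<open>L\<close> with values in
  the integers, determined by \<open>(f \<otimes> x, g \<otimes> y) \<mapsto> \<beta>(x, y) f g\<close>; the floor merely turns a real
  number that is an integer into an element of type \<open>int\<close>.\<close>

definition formal_form ::
    "('f, 'r) ring_scheme \<Rightarrow> ('v \<Rightarrow> 'v \<Rightarrow> real) \<Rightarrow>
      (('f \<times> 'v) \<Rightarrow>\<^sub>0 int) \<Rightarrow> (('f \<times> 'v) \<Rightarrow>\<^sub>0 int) \<Rightarrow> 'f" where
  "formal_form F \<beta> p q =
    (\<Oplus>\<^bsub>F\<^esub>s\<in>Poly_Mapping.keys p. \<Oplus>\<^bsub>F\<^esub>t\<in>Poly_Mapping.keys q.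
      add_pow F (Poly_Mapping.lookup p s * Poly_Mapping.lookup q t * \<lfloor>\<beta> (snd s) (snd t)\<rfloor>)
        (fst s \<otimes>\<^bsub>F\<^esub> fst t))"

definition base_change_form ::
    "('f, 'r) ring_scheme \<Rightarrow> ('v \<Rightarrow> 'v \<Rightarrow> real) \<Rightarrow>
      (('f \<times> 'v) \<Rightarrow>\<^sub>0 int) set \<Rightarrow> (('f \<times> 'v) \<Rightarrow>\<^sub>0 int) set \<Rightarrow> 'f" where
  "base_change_form F \<beta> C D = (THE r. \<forall>p\<in>C. \<forall>q\<in>D. formal_form F \<beta> p q = r)"

definition radical where
  "radical F M \<phi> = {v \<in> carrier M. \<forall>v'\<in>carrier M. \<phi> v v' = \<zero>\<^bsub>F\<^esub>}"

end

theory Submission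
  imports Defs
begin

text \<open>
  Let \<open>x = \<alpha> \<or> \<beta>\<close> be a real 2-root. Since \<open>\<alpha>\<close> and \<open>\<beta>\<close> are orthogonal, expanding
  \<open>(1 - s\<^sub>\<alpha>) (1 - s\<^sub>\<beta>) v\<close> for \<open>v\<close> in \<open>S\<^sup>2(V)\<close> leaves only \<open>B'(v, x) x\<close>
  (\<open>orthogonal_reflections\<close>). So the group ring of \<open>W\<close> contains, for every real 2-root \<open>x\<close>, an element
  acting as the rank-one operator \<open>v \<mapsto> B'(v, x) x\<close>. This is an identity over the integers on the
  lattice \<open>L\<close> spanned by \<open>\<B> \<inter> X\<close>, hence it survives the passage to \<open>N = F \<otimes> L\<close>
  (\<open>rank_one_operator\<close>).

  Let \<open>K\<close> be a submodule of \<open>N\<close> that is not contained in the radical. The elements \<open>1 \<otimes> x\<close> with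
  \<open>x \<in> \<B> \<inter> X\<close> generate \<open>N\<close>, so \<open>B'(v, 1 \<otimes> x) \<noteq> 0\<close> for some such \<open>x\<close> and some \<open>v \<in> K\<close>. The operator above
  gives \<open>1 \<otimes> x \<in> K\<close>, because \<open>F\<close> is a field; as \<open>W\<close> is transitive on \<open>X\<close>, all \<open>1 \<otimes> y\<close> with
  \<open>y \<in> \<B> \<inter> X\<close> lie in \<open>K\<close>, and \<open>K = N\<close> (\<open>submodule_in_radical_or_full\<close>). The radical is a submodule by
  invariance of \<open>B'\<close>, and it is proper because \<open>B'\<close> does not vanish on \<open>N\<close>; so it contains all proper
  submodules. The assertions about maximal submodules, the quotient, indecomposability and
  irreducibility hold for every module with a largest proper submodule
  (\<open>largest_proper_submodule\<close>).

  All of this presupposes that \<open>W\<close> acts on \<open>L\<close>, for which it is enough to treat the simple reflections.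
  If \<open>b \<in> \<B>\<close> then \<open>s\<^sub>k b\<close> is one of \<open>b\<close>, \<open>-b\<close> and \<open>b + y\<close> with \<open>y \<in> \<B>\<close> in the \<open>W\<close>-orbit of \<open>b\<close>
  (\<open>simple_reflection_canonical_basis\<close>). This is where the shape of the diagram and the three kinds
  of elementary roots enter (\<open>shape_step_adjacent\<close>).
\<close>

section \<open>Modules with a group action and their quotients\<close>

context abelian_subgroup
begin

text \<open>A map on cosets that is defined as a union over representatives can be evaluated at one
  representative.\<close>

lemma coset_map_rcos:
  assumes closed: "\<And>x. x \<in> carrier G \<Longrightarrow> f x \<in> carrier G"
    and add: "\<And>x y. x \<in> carrier G \<Longrightarrow> y \<in> carrier G \<Longrightarrow> f (x \<oplus> y) = f x \<oplus> f y"
    and stable: "\<And>h. h \<in> H \<Longrightarrow> f h \<in> H"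
    and x: "x \<in> carrier G"
  shows "coset_map G H f (H +> x) = H +> f x"
proof -
  have "H +> f y = H +> f x" if y: "y \<in> H +> x" for y
  proof -
    obtain h where h: "h \<in> H" "y = h \<oplus> x"
      using y by (auto simp: a_r_coset_def')
    then have "f y = f h \<oplus> f x"
      using x by (simp add: add)
    then have "f y \<in> H +> f x"
      using stable[OF h(1)] by (auto simp: a_r_coset_def')
    then show ?thesis
      using a_repr_independence' closed x by blast
  qed
  moreover have "x \<in> H +> x"
    using x by (rule a_rcos_self)
  ultimately show ?thesis
    unfolding coset_map_def by blast
qed

lemma rcos_eq_iff:
  assumes "x \<in> carrier G" "y \<in> carrier G"
  shows "H +> x = H +> y \<longleftrightarrow> x \<ominus> y \<in> H"
  using assms a_rcos_module[OF assms(2,1)] a_repr_independence'[of x y]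
    a_repr_independenceD[of x y] by (auto simp: a_minus_def)

end

text \<open>An additive subgroup of the carrier of a module record, so that \<open>quotient_module\<close> applies. The
  scalars satisfy no axioms here: the formal tensors below, from which extensions of scalars are
  formed, are not a module over the coefficient ring.\<close>

locale module_quotient = abelian_subgroup H M
  for H :: "'b set" and M :: "('a, 'b, 'm) module_scheme" (structure)
begin

lemma rcos_in_quotient: "x \<in> carrier M \<Longrightarrow> H +> x \<in> carrier (quotient_module M H)"
  using a_subset by (simp add: quotient_module_def a_rcosetsI)

lemma quotient_cases:
  assumes "C \<in> carrier (quotient_module M H)"
  obtains x where "x \<in> carrier M" "C = H +> x"
  using assms by (auto simp: quotient_module_def A_RCOSETS_def')

lemma quotient_add:
  assumes "x \<in> carrier M" "y \<in> carrier M"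
  shows "(H +> x) \<oplus>\<^bsub>quotient_module M H\<^esub> (H +> y) = H +> (x \<oplus> y)"
  using a_rcos_sum[OF assms] by (simp add: quotient_module_def)

lemma quotient_zero: "\<zero>\<^bsub>quotient_module M H\<^esub> = H"
  by (simp add: quotient_module_def)

lemma abelian_group_quotient_module: "abelian_group (quotient_module M H)"
proof (rule abelian_groupI)
  have zero: "\<zero>\<^bsub>quotient_module M H\<^esub> = H +> \<zero>"
    using a_subset by (simp add: quotient_zero)
  show "\<zero>\<^bsub>quotient_module M H\<^esub> \<in> carrier (quotient_module M H)"
    unfolding zero by (simp add: rcos_in_quotient)
  show "\<zero>\<^bsub>quotient_module M H\<^esub> \<oplus>\<^bsub>quotient_module M H\<^esub> C = C"
    if "C \<in> carrier (quotient_module M H)" for C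
    using that unfolding zero by (auto elim!: quotient_cases simp: quotient_add)
  show "\<exists>D\<in>carrier (quotient_module M H). D \<oplus>\<^bsub>quotient_module M H\<^esub> C = \<zero>\<^bsub>quotient_module M H\<^esub>"
    if C: "C \<in> carrier (quotient_module M H)" for C
  proof -
    obtain x where "x \<in> carrier M" "C = H +> x"
      using C by (rule quotient_cases)
    then show ?thesis
      unfolding zero
      by (intro bexI[of _ "H +> \<ominus> x"]) (simp_all add: quotient_add rcos_in_quotient l_neg)
  qed
qed (auto elim!: quotient_cases intro!: rcos_in_quotient simp: quotient_add a_ac)

end

context group_module
begin

lemma group_submodule_module_quotient:
  assumes "group_submodule F G M \<rho> H"
  shows "module_quotient H M"
  using assms M.abelian_group_axioms
  by (intro module_quotient.intro abelian_subgroupI3 additive_subgroup.intro)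
    (auto simp: group_submodule_def submodule_def)

lemma quotient_smult:
  assumes "group_submodule F G M \<rho> H" "r \<in> carrier F" "x \<in> carrier M"
  shows "r \<odot>\<^bsub>quotient_module M H\<^esub> (H +>\<^bsub>M\<^esub> x) = H +>\<^bsub>M\<^esub> (r \<odot>\<^bsub>M\<^esub> x)"
proof -
  interpret H: module_quotient H M
    by (rule group_submodule_module_quotient[OF assms(1)])
  have "coset_map M H (\<lambda>x. r \<odot>\<^bsub>M\<^esub> x) (H +>\<^bsub>M\<^esub> x) = H +>\<^bsub>M\<^esub> (r \<odot>\<^bsub>M\<^esub> x)"
    using assms
    by (intro H.coset_map_rcos) (auto simp: smult_r_distr group_submodule_def intro: submodule.smult_closed)
  then show ?thesis
    by (simp add: quotient_module_def)
qed

lemma quotient_act: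
  assumes "group_submodule F G M \<rho> H" "g \<in> carrier G" "x \<in> carrier M"
  shows "quotient_act M H \<rho> g (H +>\<^bsub>M\<^esub> x) = H +>\<^bsub>M\<^esub> \<rho> g x"
proof -
  interpret H: module_quotient H M
    by (rule group_submodule_module_quotient[OF assms(1)])
  show ?thesis
    using assms unfolding quotient_act_def
    by (intro H.coset_map_rcos) (auto simp: act_add act_closed group_submodule_def)
qed

lemma group_module_quotient:
  assumes H: "group_submodule F G M \<rho> H"
  shows "group_module F G (quotient_module M H) (quotient_act M H \<rho>)"
proof -
  interpret H: module_quotient H M
    by (rule group_submodule_module_quotient[OF assms(1)])
  let ?Q = "quotient_module M H"
  have mod: "Module.module F ?Q"
  proof (rule moduleI)
    show "cring F" by (rule R.cring_axioms)
    show "abelian_group ?Q" by (rule H.abelian_group_quotient_module)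
  qed (auto elim!: H.quotient_cases intro!: H.rcos_in_quotient
      simp: H.quotient_add quotient_smult[OF H] smult_l_distr smult_r_distr smult_assoc1)
  show ?thesis
    unfolding group_module_def
  proof (intro conjI)
    show "group_module_axioms F G ?Q (quotient_act M H \<rho>)"
      by unfold_locales
        (auto elim!: H.quotient_cases intro!: H.rcos_in_quotient
          simp: H.quotient_add quotient_smult[OF H] quotient_act[OF H] act_add act_closed act_one
            act_mult act_smult)
  qed (rule mod G.group_axioms)+
qed

lemma group_submodule_quotient_preimage:
  assumes H: "group_submodule F G M \<rho> H"
    and K: "group_submodule F G (quotient_module M H) (quotient_act M H \<rho>) K"
  shows "group_submodule F G M \<rho> {x \<in> carrier M. H +>\<^bsub>M\<^esub> x \<in> K}"
proof -
  interpret H: module_quotient H M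
    by (rule group_submodule_module_quotient[OF H])
  interpret Q: group_module F G "quotient_module M H" "quotient_act M H \<rho>"
    by (rule group_module_quotient[OF H])
  have sub: "submodule K F (quotient_module M H)"
    and act: "\<And>g C. g \<in> carrier G \<Longrightarrow> C \<in> K \<Longrightarrow> quotient_act M H \<rho> g C \<in> K"
    using K by (auto simp: group_submodule_def)
  note K' = Q.submoduleE[OF sub]
  have HK: "H \<in> K"
    using subgroup.one_closed[OF submodule.axioms(1)[OF sub]] by (simp add: H.quotient_zero)
  have neg: "H +>\<^bsub>M\<^esub> (\<ominus>\<^bsub>M\<^esub> x) \<in> K" if "x \<in> carrier M" "H +>\<^bsub>M\<^esub> x \<in> K" for x
    using K'(4)[of "\<ominus> \<one>" "H +>\<^bsub>M\<^esub> x"] that by (simp add: quotient_smult[OF H] smult_l_minus)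
  have "submodule {x \<in> carrier M. H +>\<^bsub>M\<^esub> x \<in> K} F M"
  proof (rule submoduleI)
    show "\<zero>\<^bsub>M\<^esub> \<in> {x \<in> carrier M. H +>\<^bsub>M\<^esub> x \<in> K}"
      using HK H.a_subset by simp
  next
    fix x y assume "x \<in> {x \<in> carrier M. H +>\<^bsub>M\<^esub> x \<in> K}" "y \<in> {x \<in> carrier M. H +>\<^bsub>M\<^esub> x \<in> K}"
    then show "x \<oplus>\<^bsub>M\<^esub> y \<in> {x \<in> carrier M. H +>\<^bsub>M\<^esub> x \<in> K}"
      using K'(5)[of "H +>\<^bsub>M\<^esub> x" "H +>\<^bsub>M\<^esub> y"] by (simp add: H.quotient_add)
  next
    fix r x assume "r \<in> carrier F" "x \<in> {x \<in> carrier M. H +>\<^bsub>M\<^esub> x \<in> K}"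
    then show "r \<odot>\<^bsub>M\<^esub> x \<in> {x \<in> carrier M. H +>\<^bsub>M\<^esub> x \<in> K}"
      using K'(4)[of r "H +>\<^bsub>M\<^esub> x"] by (simp add: quotient_smult[OF H])
  qed (use neg in auto)
  then show ?thesis
    using act by (auto simp: group_submodule_def act_closed simp flip: quotient_act[OF H])
qed

text \<open>Two proper submodules both lie in \<open>R\<close>, so they cannot sum to the whole module, which excludes a
  direct decomposition. The submodules of the quotient by \<open>R\<close> are images of submodules that contain
  \<open>R\<close>, of which there are only two.\<close>

lemma largest_proper_submodule:
  assumes R: "group_submodule F G M \<rho> R" and proper: "R \<noteq> carrier M"
    and largest: "\<And>K. group_submodule F G M \<rho> K \<Longrightarrow> K \<subseteq> R \<or> K = carrier M"
  shows "maximal_group_submodule F G M \<rho> H \<longleftrightarrow> H = R"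
    and "irreducible_group_module F G (quotient_module M R) (quotient_act M R \<rho>)"
    and "indecomposable_group_module F G M \<rho>"
    and "irreducible_group_module F G M \<rho> \<longleftrightarrow> R = {\<zero>\<^bsub>M\<^esub>}"
proof -
  interpret R: module_quotient R M
    by (rule group_submodule_module_quotient[OF R])
  have subset: "K \<subseteq> carrier M" if "group_submodule F G M \<rho> K" for K
    using that submoduleE(1) by (auto simp: group_submodule_def)
  have zero_in: "\<zero>\<^bsub>M\<^esub> \<in> K" if "group_submodule F G M \<rho> K" for K
    using that subgroup.one_closed[OF submodule.axioms(1)[of K F M]] by (simp add: group_submodule_def)
  have nonzero: "carrier M \<noteq> {\<zero>\<^bsub>M\<^esub>}"
    using proper zero_in[OF R] subset[OF R] by auto
  show "maximal_group_submodule F G M \<rho> H \<longleftrightarrow> H = R"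
  proof
    show "H = R" if H: "maximal_group_submodule F G M \<rho> H"
    proof -
      have "group_submodule F G M \<rho> H" "H \<noteq> carrier M"
        using H by (simp_all add: maximal_group_submodule_def)
      then have "H \<subseteq> R"
        using largest by blast
      then show ?thesis
        using H R proper by (auto simp: maximal_group_submodule_def)
    qed
    show "maximal_group_submodule F G M \<rho> H" if "H = R"
      unfolding maximal_group_submodule_def
    proof (intro conjI allI impI)
      fix K assume K: "group_submodule F G M \<rho> K \<and> H \<subseteq> K"
      show "K = H \<or> K = carrier M"
        using largest[OF conjunct1[OF K]] K that by blast
    qed (use that R proper in simp_all)
  qed
  show "indecomposable_group_module F G M \<rho>"
    unfolding indecomposable_group_module_def
  proof (intro conjI notI)
    show "group_module F G M \<rho>" by (rule group_module_axioms)
  next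
    assume "\<exists>U U'. group_submodule F G M \<rho> U \<and> group_submodule F G M \<rho> U' \<and>
        U \<noteq> {\<zero>\<^bsub>M\<^esub>} \<and> U' \<noteq> {\<zero>\<^bsub>M\<^esub>} \<and> U \<inter> U' = {\<zero>\<^bsub>M\<^esub>} \<and> U <+>\<^bsub>M\<^esub> U' = carrier M"
    then obtain U U' where U: "group_submodule F G M \<rho> U" "group_submodule F G M \<rho> U'"
      "U \<noteq> {\<zero>\<^bsub>M\<^esub>}" "U' \<noteq> {\<zero>\<^bsub>M\<^esub>}" "U \<inter> U' = {\<zero>\<^bsub>M\<^esub>}" "U <+>\<^bsub>M\<^esub> U' = carrier M"
      by blast
    have "U \<noteq> carrier M" "U' \<noteq> carrier M"
      using U subset[OF U(1)] subset[OF U(2)] by auto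
    then have "U \<subseteq> R" "U' \<subseteq> R"
      using largest[OF U(1)] largest[OF U(2)] by auto
    then have "U <+>\<^bsub>M\<^esub> U' \<subseteq> R"
      by (auto simp: set_add_def')
    then show False
      using U(6) proper subset[OF R] by auto
  qed (use nonzero in auto)
  show "irreducible_group_module F G M \<rho> \<longleftrightarrow> R = {\<zero>\<^bsub>M\<^esub>}"
  proof
    show "R = {\<zero>\<^bsub>M\<^esub>}" if "irreducible_group_module F G M \<rho>"
      using that R proper by (auto simp: irreducible_group_module_def)
    show "irreducible_group_module F G M \<rho>" if "R = {\<zero>\<^bsub>M\<^esub>}"
      unfolding irreducible_group_module_def
    proof (intro conjI allI impI)
      fix K assume K: "group_submodule F G M \<rho> K"
      show "K = {\<zero>\<^bsub>M\<^esub>} \<or> K = carrier M"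
        using largest[OF K] zero_in[OF K] that by blast
    qed (rule group_module_axioms nonzero)+
  qed
  show "irreducible_group_module F G (quotient_module M R) (quotient_act M R \<rho>)"
    unfolding irreducible_group_module_def
  proof (intro conjI allI impI)
    show "group_module F G (quotient_module M R) (quotient_act M R \<rho>)"
      by (rule group_module_quotient[OF R])
    obtain x where x: "x \<in> carrier M" "x \<notin> R"
      using proper subset[OF R] by auto
    then have "R +>\<^bsub>M\<^esub> x \<noteq> R"
      using R.a_rcos_self[OF x(1)] by metis
    then show "carrier (quotient_module M R) \<noteq> {\<zero>\<^bsub>quotient_module M R\<^esub>}"
      unfolding R.quotient_zero using R.rcos_in_quotient[OF x(1)] by blast
  next
    fix K assume K: "group_submodule F G (quotient_module M R) (quotient_act M R \<rho>) K"
    interpret Q: group_module F G "quotient_module M R" "quotient_act M R \<rho>"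
      by (rule group_module_quotient[OF R])
    have Ksub: "K \<subseteq> carrier (quotient_module M R)"
      using K Q.submoduleE(1)[of K] by (simp add: group_submodule_def quotient_module_def)
    have "R \<in> K"
      using K subgroup.one_closed[OF submodule.axioms(1)[of K F "quotient_module M R"]]
      by (simp add: group_submodule_def R.quotient_zero)
    let ?P = "{x \<in> carrier M. R +>\<^bsub>M\<^esub> x \<in> K}"
    consider "?P \<subseteq> R" | "?P = carrier M"
      using largest[OF group_submodule_quotient_preimage[OF R K]] by blast
    then show "K = {\<zero>\<^bsub>quotient_module M R\<^esub>} \<or> K = carrier (quotient_module M R)"
    proof cases
      case 1
      have "C = R" if "C \<in> K" for C
      proof -
        have "C \<in> carrier (quotient_module M R)"
          using that Ksub by blast
        then obtain x where "x \<in> carrier M" "C = R +>\<^bsub>M\<^esub> x"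
          by (rule R.quotient_cases)
        moreover from this have "x \<in> R"
          using 1 that by blast
        ultimately show ?thesis
          by (simp add: R.a_rcos_const)
      qed
      then show ?thesis
        unfolding R.quotient_zero using \<open>R \<in> K\<close> by blast
    next
      case 2
      have "C \<in> K" if C: "C \<in> carrier (quotient_module M R)" for C
      proof -
        obtain x where "x \<in> carrier M" "C = R +>\<^bsub>M\<^esub> x"
          using C by (rule R.quotient_cases)
        then show ?thesis
          using 2 by blast
      qed
      then show ?thesis
        using Ksub by blast
    qed
  qed
qed

end

section \<open>The radical of an invariant form\<close>

text \<open>For a form that is not symmetric, \<open>radical\<close> is the left radical.\<close>

locale invariant_form = group_module +
  fixes \<phi>
  assumes form_closed: "x \<in> carrier M \<Longrightarrow> y \<in> carrier M \<Longrightarrow> \<phi> x y \<in> carrier F"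
    and form_add_left: "x \<in> carrier M \<Longrightarrow> x' \<in> carrier M \<Longrightarrow> y \<in> carrier M \<Longrightarrow>
      \<phi> (x \<oplus>\<^bsub>M\<^esub> x') y = \<phi> x y \<oplus> \<phi> x' y"
    and form_add_right: "x \<in> carrier M \<Longrightarrow> y \<in> carrier M \<Longrightarrow> y' \<in> carrier M \<Longrightarrow>
      \<phi> x (y \<oplus>\<^bsub>M\<^esub> y') = \<phi> x y \<oplus> \<phi> x y'"
    and form_smult_left: "r \<in> carrier F \<Longrightarrow> x \<in> carrier M \<Longrightarrow> y \<in> carrier M \<Longrightarrow>
      \<phi> (r \<odot>\<^bsub>M\<^esub> x) y = r \<otimes> \<phi> x y"
    and form_smult_right: "r \<in> carrier F \<Longrightarrow> x \<in> carrier M \<Longrightarrow> y \<in> carrier M \<Longrightarrow>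
      \<phi> x (r \<odot>\<^bsub>M\<^esub> y) = r \<otimes> \<phi> x y"
    and form_act: "g \<in> carrier G \<Longrightarrow> x \<in> carrier M \<Longrightarrow> y \<in> carrier M \<Longrightarrow>
      \<phi> (\<rho> g x) (\<rho> g y) = \<phi> x y"
begin

lemma submodule_kernel:
  assumes "y \<in> carrier M"
  shows "submodule {x \<in> carrier M. \<phi> x y = \<zero>} F M" "submodule {x \<in> carrier M. \<phi> y x = \<zero>} F M"
proof -
  have z: "\<phi> \<zero>\<^bsub>M\<^esub> y = \<zero>" "\<phi> y \<zero>\<^bsub>M\<^esub> = \<zero>"
    using form_smult_left[of \<zero> "\<zero>\<^bsub>M\<^esub>" y] form_smult_right[of \<zero> y "\<zero>\<^bsub>M\<^esub>"] assms
    by (simp_all add: form_closed)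
  have n: "\<phi> (\<ominus>\<^bsub>M\<^esub> x) y = \<ominus> \<one> \<otimes> \<phi> x y" "\<phi> y (\<ominus>\<^bsub>M\<^esub> x) = \<ominus> \<one> \<otimes> \<phi> y x" if "x \<in> carrier M" for x
    using form_smult_left[of "\<ominus> \<one>" x y] form_smult_right[of "\<ominus> \<one>" y x] assms that
    by (simp_all add: smult_l_minus)
  show "submodule {x \<in> carrier M. \<phi> x y = \<zero>} F M" "submodule {x \<in> carrier M. \<phi> y x = \<zero>} F M"
    using assms
    by (auto intro!: submoduleI simp: z n form_add_left form_add_right form_smult_left form_smult_right)
qed

lemma group_submodule_radical: "group_submodule F G M \<rho> (radical F M \<phi>)"
  unfolding group_submodule_def
proof (intro conjI ballI)
  show "submodule (radical F M \<phi>) F M"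
    using submoduleE[OF submodule_kernel(1)]
    by (intro submoduleI) (auto simp: radical_def form_add_left form_smult_left
        dest: subgroup.one_closed[OF submodule.axioms(1)[OF submodule_kernel(1)]])
next
  fix g x assume g: "g \<in> carrier G" and x: "x \<in> radical F M \<phi>"
  have "\<phi> (\<rho> g x) y = \<zero>" if y: "y \<in> carrier M" for y
  proof -
    have "\<rho> g (\<rho> (inv\<^bsub>G\<^esub> g) y) = y"
      using g y act_mult[of g "inv\<^bsub>G\<^esub> g" y] by (simp add: act_one)
    then have "\<phi> (\<rho> g x) y = \<phi> x (\<rho> (inv\<^bsub>G\<^esub> g) y)"
      using form_act[of g x "\<rho> (inv\<^bsub>G\<^esub> g) y"] g x y by (simp add: act_closed radical_def)
    then show ?thesis
      using g x y by (simp add: act_closed radical_def)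
  qed
  then show "\<rho> g x \<in> radical F M \<phi>"
    using g x by (simp add: radical_def act_closed)
qed

text \<open>The hypothesis \<open>rank_one\<close> says that the operator \<open>x \<mapsto> \<phi>(x, t) t\<close> preserves every submodule, as it
  does when it is the action of an element of the group ring. A submodule not orthogonal to some
  \<open>t \<in> T\<close> then contains a nonzero multiple of \<open>t\<close>, hence \<open>t\<close>, hence all of \<open>T\<close>, which
  generates the module.\<close>

lemma submodule_in_radical_or_full:
  assumes field: "field F"
    and T: "T \<subseteq> carrier M"
    and generates: "\<And>K. submodule K F M \<Longrightarrow> T \<subseteq> K \<Longrightarrow> K = carrier M"
    and transitive: "\<And>s t. s \<in> T \<Longrightarrow> t \<in> T \<Longrightarrow> \<exists>g\<in>carrier G. \<rho> g s = t"
    and rank_one: "\<And>K x t. group_submodule F G M \<rho> K \<Longrightarrow> x \<in> K \<Longrightarrow> t \<in> T \<Longrightarrow> \<phi> x t \<odot>\<^bsub>M\<^esub> t \<in> K"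
    and K: "group_submodule F G M \<rho> K"
  shows "K \<subseteq> radical F M \<phi> \<or> K = carrier M"
proof (rule disjCI)
  interpret field F by (rule field)
  assume "K \<noteq> carrier M"
  have Ks: "submodule K F M" and Ka: "\<And>g x. g \<in> carrier G \<Longrightarrow> x \<in> K \<Longrightarrow> \<rho> g x \<in> K"
    using K by (auto simp: group_submodule_def)
  note K' = submoduleE[OF Ks]
  show "K \<subseteq> radical F M \<phi>"
  proof
    fix x assume x: "x \<in> K"
    then have xM: "x \<in> carrier M" using K'(1) by blast
    have "\<phi> x t = \<zero>" if t: "t \<in> T" for t
    proof (rule ccontr)
      assume nz: "\<phi> x t \<noteq> \<zero>"
      have tM: "t \<in> carrier M" using T t by blast
      have u: "\<phi> x t \<in> Units F"
        using nz xM tM by (simp add: field_Units form_closed)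
      have "inv \<phi> x t \<odot>\<^bsub>M\<^esub> (\<phi> x t \<odot>\<^bsub>M\<^esub> t) \<in> K"
        using u by (intro K'(4) rank_one[OF K x t]) simp
      then have "t \<in> K"
        using u tM by (simp flip: smult_assoc1 add: form_closed xM)
      then have "T \<subseteq> K"
        using transitive[OF t] Ka by blast
      then show False
        using generates[OF Ks] \<open>K \<noteq> carrier M\<close> by blast
    qed
    then have "T \<subseteq> {y \<in> carrier M. \<phi> x y = \<zero>}"
      using T by blast
    then have "{y \<in> carrier M. \<phi> x y = \<zero>} = carrier M"
      by (intro generates submodule_kernel xM)
    then show "x \<in> radical F M \<phi>"
      using xM by (auto simp: radical_def)
  qed
qed

end

section \<open>Extension of scalars\<close>

text \<open>The tensor product \<open>F \<otimes> L\<close> over the integers. All later facts about it are derived from two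
  properties of the pure tensors \<open>f \<otimes> x\<close>: they are biadditive, and they generate
  (\<open>base_change_induct\<close>).\<close>

locale scalar_extension = F?: cring F for F :: "('f, 'r) ring_scheme" (structure) +
  fixes L :: "'v::ab_group_add set"
  assumes zero_in_L: "0 \<in> L"
    and diff_in_L: "x \<in> L \<Longrightarrow> y \<in> L \<Longrightarrow> x - y \<in> L"
begin

lemma uminus_in_L: "x \<in> L \<Longrightarrow> - x \<in> L"
  using diff_in_L[OF zero_in_L] by fastforce

lemma add_in_L: "x \<in> L \<Longrightarrow> y \<in> L \<Longrightarrow> x + y \<in> L"
  using diff_in_L[OF _ uminus_in_L] by fastforce

abbreviation T where "T \<equiv> formal_tensors F L"
abbreviation Rel where "Rel \<equiv> tensor_relations F L"
abbreviation N where "N \<equiv> base_change F L"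

lemma formal_tensors_simps:
  "x \<in> carrier T \<longleftrightarrow> Poly_Mapping.keys x \<subseteq> carrier F \<times> L" "\<zero>\<^bsub>T\<^esub> = 0" "x \<oplus>\<^bsub>T\<^esub> y = x + y"
  "r \<odot>\<^bsub>T\<^esub> x = frag_extend (\<lambda>(f, x). frag_of (r \<otimes> f, x)) x"
  by (simp_all add: formal_tensors_def)

lemma abelian_group_formal_tensors: "abelian_group T"
proof (rule abelian_groupI)
  fix x y assume "x \<in> carrier T" "y \<in> carrier T"
  then show "x \<oplus>\<^bsub>T\<^esub> y \<in> carrier T"
    using keys_add[of x y] by (auto simp: formal_tensors_simps)
next
  fix x assume "x \<in> carrier T"
  then show "\<exists>y\<in>carrier T. y \<oplus>\<^bsub>T\<^esub> x = \<zero>\<^bsub>T\<^esub>"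
    by (intro bexI[of _ "- x"]) (simp_all add: formal_tensors_simps)
qed (simp_all add: formal_tensors_simps add.assoc add.commute)

text \<open>The zero case of \<open>group_closure.induct\<close> is covered by the difference of a relation with
  itself, since relations exist: \<open>0 \<in> L\<close>.\<close>

lemma tensor_relations_induct [consumes 1, case_names left right diff]:
  assumes "p \<in> Rel"
    and "\<And>f g x. f \<in> carrier F \<Longrightarrow> g \<in> carrier F \<Longrightarrow> x \<in> L \<Longrightarrow>
      P (frag_of (f \<oplus> g, x) - frag_of (f, x) - frag_of (g, x))"
    and "\<And>f x y. f \<in> carrier F \<Longrightarrow> x \<in> L \<Longrightarrow> y \<in> L \<Longrightarrow>
      P (frag_of (f, x + y) - frag_of (f, x) - frag_of (f, y))"
    and diff: "\<And>p q. p \<in> Rel \<Longrightarrow> q \<in> Rel \<Longrightarrow> P p \<Longrightarrow> P q \<Longrightarrow> P (p - q)"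
  shows "P p"
proof -
  define z where "z = frag_of (\<zero> \<oplus> \<zero>, 0 :: 'v) - frag_of (\<zero>, 0) - frag_of (\<zero>, 0)"
  have "z \<in> Rel" "P z"
    using assms(2)[of \<zero> \<zero> 0] zero_in_L unfolding z_def tensor_relations_def
    by (fastforce intro!: group_closure.base)+
  then have "P 0"
    using diff[of z z] by simp
  show ?thesis
    using assms(1)[unfolded tensor_relations_def]
  proof (induction rule: group_closure.induct)
    case (base s)
    then show ?case
      using \<open>P 0\<close> assms(2,3) by blast
  next
    case (diff s t)
    then show ?case
      using assms(4)[of s t] by (simp add: tensor_relations_def)
  qed
qed

lemma tensor_relations_subset: "p \<in> Rel \<Longrightarrow> p \<in> carrier T"
proof (induction rule: tensor_relations_induct)
  case (left f g x)
  then show ?case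
    unfolding formal_tensors_simps
    by (intro order_trans[OF keys_diff] Un_least) auto
next
  case (right f x y)
  then show ?case
    unfolding formal_tensors_simps
    by (intro order_trans[OF keys_diff] Un_least) (auto intro: add_in_L)
next
  case (diff p q)
  then show ?case
    unfolding formal_tensors_simps
    by (intro order_trans[OF keys_diff] Un_least)
qed

lemma formal_tensors_uminus:
  assumes "x \<in> carrier T"
  shows "\<ominus>\<^bsub>T\<^esub> x = - x"
proof -
  interpret T: abelian_group T by (rule abelian_group_formal_tensors)
  show ?thesis
    using assms by (intro T.minus_equality) (simp_all add: formal_tensors_simps)
qed

lemma module_quotient_tensor_relations: "module_quotient Rel T"
proof (intro module_quotient.intro abelian_subgroupI3 additive_subgroup.intro)
  interpret T: abelian_group T by (rule abelian_group_formal_tensors)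
  show "subgroup Rel (add_monoid T)"
  proof (rule T.add.subgroupI)
    show "Rel \<subseteq> carrier T"
      using tensor_relations_subset by blast
    show "Rel \<noteq> {}"
      unfolding tensor_relations_def using zero_in_group_closure by blast
    show "\<ominus>\<^bsub>T\<^esub> p \<in> Rel" if "p \<in> Rel" for p
      using that by (simp add: formal_tensors_uminus tensor_relations_subset) (simp add: tensor_relations_def)
    show "p \<oplus>\<^bsub>T\<^esub> q \<in> Rel" if "p \<in> Rel" "q \<in> Rel" for p q
      using that by (simp add: formal_tensors_simps tensor_relations_def group_closure_add)
  qed
qed (rule abelian_group_formal_tensors)

sublocale Q: module_quotient Rel T
  by (rule module_quotient_tensor_relations)

lemma abelian_group_N: "abelian_group N"
  unfolding base_change_def by (rule Q.abelian_group_quotient_module)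

sublocale N: abelian_group N
  by (rule abelian_group_N)

definition pure (infixl \<open>\<otimes>\<^sub>t\<close> 75) where
  "f \<otimes>\<^sub>t x = Rel +>\<^bsub>T\<^esub> frag_of (f, x)"

lemma frag_of_in_T: "f \<in> carrier F \<Longrightarrow> x \<in> L \<Longrightarrow> frag_of (f, x) \<in> carrier T"
  by (simp add: formal_tensors_simps)

lemma pure_closed: "f \<in> carrier F \<Longrightarrow> x \<in> L \<Longrightarrow> f \<otimes>\<^sub>t x \<in> carrier N"
  by (simp add: pure_def base_change_def Q.rcos_in_quotient frag_of_in_T)

lemma base_change_cases:
  assumes "C \<in> carrier N"
  obtains p where "p \<in> carrier T" "C = Rel +>\<^bsub>T\<^esub> p"
  using assms unfolding base_change_def by (rule Q.quotient_cases)

lemma N_add: "p \<in> carrier T \<Longrightarrow> q \<in> carrier T \<Longrightarrow> (Rel +>\<^bsub>T\<^esub> p) \<oplus>\<^bsub>N\<^esub> (Rel +>\<^bsub>T\<^esub> q) = Rel +>\<^bsub>T\<^esub> (p + q)"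
  unfolding base_change_def by (simp add: Q.quotient_add formal_tensors_simps(3))

lemma rcos_eqI:
  assumes "p \<in> carrier T" "q \<in> carrier T" "p - q \<in> Rel"
  shows "Rel +>\<^bsub>T\<^esub> p = Rel +>\<^bsub>T\<^esub> q"
  using assms by (simp add: Q.rcos_eq_iff a_minus_def formal_tensors_uminus formal_tensors_simps(3))

lemma pure_add_left:
  assumes "f \<in> carrier F" "g \<in> carrier F" "x \<in> L"
  shows "(f \<oplus> g) \<otimes>\<^sub>t x = f \<otimes>\<^sub>t x \<oplus>\<^bsub>N\<^esub> g \<otimes>\<^sub>t x"
proof -
  have "frag_of (f \<oplus> g, x) - frag_of (f, x) - frag_of (g, x) \<in> Rel"
    unfolding tensor_relations_def using assms by (intro group_closure.base) blast
  moreover have "frag_of (f, x) + frag_of (g, x) \<in> carrier T"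
    using assms Q.add.m_closed[of "frag_of (f, x)" "frag_of (g, x)"] by (simp add: frag_of_in_T formal_tensors_simps(3))
  ultimately show ?thesis
    unfolding pure_def using assms
    by (simp add: N_add frag_of_in_T diff_diff_add rcos_eqI)
qed

lemma pure_add_right:
  assumes "f \<in> carrier F" "x \<in> L" "y \<in> L"
  shows "f \<otimes>\<^sub>t (x + y) = f \<otimes>\<^sub>t x \<oplus>\<^bsub>N\<^esub> f \<otimes>\<^sub>t y"
proof -
  have "frag_of (f, x + y) - frag_of (f, x) - frag_of (f, y) \<in> Rel"
    unfolding tensor_relations_def using assms by (intro group_closure.base) blast
  moreover have "frag_of (f, x) + frag_of (f, y) \<in> carrier T"
    using assms Q.add.m_closed[of "frag_of (f, x)" "frag_of (f, y)"] by (simp add: frag_of_in_T formal_tensors_simps(3))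
  ultimately show ?thesis
    unfolding pure_def using assms
    by (simp add: N_add frag_of_in_T diff_diff_add rcos_eqI add_in_L)
qed

lemma pure_zero_left: "x \<in> L \<Longrightarrow> \<zero> \<otimes>\<^sub>t x = \<zero>\<^bsub>N\<^esub>"
  using pure_add_left[of \<zero> \<zero> x] pure_closed[of \<zero> x] by simp

lemma pure_zero_right: "f \<in> carrier F \<Longrightarrow> f \<otimes>\<^sub>t 0 = \<zero>\<^bsub>N\<^esub>"
  using pure_add_right[of f 0 0] pure_closed[of f 0] by (simp add: zero_in_L)

lemma pure_uminus_left:
  assumes "f \<in> carrier F" "x \<in> L"
  shows "(\<ominus> f) \<otimes>\<^sub>t x = \<ominus>\<^bsub>N\<^esub> (f \<otimes>\<^sub>t x)"
  using pure_add_left[of "\<ominus> f" f x] assms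
  by (intro N.minus_equality[symmetric]) (simp_all add: pure_closed l_neg pure_zero_left)

lemma pure_uminus_right:
  assumes "f \<in> carrier F" "x \<in> L"
  shows "f \<otimes>\<^sub>t (- x) = \<ominus>\<^bsub>N\<^esub> (f \<otimes>\<^sub>t x)"
  using pure_add_right[of f "- x" x] assms
  by (intro N.minus_equality[symmetric]) (simp_all add: pure_closed uminus_in_L pure_zero_right)

lemma pure_diff:
  assumes "f \<in> carrier F" "x \<in> L" "y \<in> L"
  shows "f \<otimes>\<^sub>t (x - y) = f \<otimes>\<^sub>t x \<ominus>\<^bsub>N\<^esub> f \<otimes>\<^sub>t y"
  using pure_add_right[of f x "- y"] assms by (simp add: a_minus_def pure_uminus_right uminus_in_L)

text \<open>Negatives need no case of their own, because \<open>-(f \<otimes> x) = (-f) \<otimes> x\<close> is again a pure tensor.\<close>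

lemma base_change_induct [consumes 1, case_names pure add]:
  assumes "C \<in> carrier N"
    and pure: "\<And>f x. f \<in> carrier F \<Longrightarrow> x \<in> L \<Longrightarrow> P (f \<otimes>\<^sub>t x)"
    and add: "\<And>C D. C \<in> carrier N \<Longrightarrow> D \<in> carrier N \<Longrightarrow> P C \<Longrightarrow> P D \<Longrightarrow> P (C \<oplus>\<^bsub>N\<^esub> D)"
  shows "P C"
proof -
  obtain p where p: "p \<in> carrier T" "C = Rel +>\<^bsub>T\<^esub> p"
    using assms(1) by (rule base_change_cases)
  have coset: "Rel +>\<^bsub>T\<^esub> q \<in> carrier N" if "q \<in> carrier T" for q
    using Q.rcos_in_quotient[OF that] by (simp add: base_change_def)
  have neg: "- q \<in> carrier T" if "q \<in> carrier T" for q
    using that by (simp add: formal_tensors_simps)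
  \<comment> \<open>carried along with its negative, because the induction on the free group forms differences\<close>
  have "P (Rel +>\<^bsub>T\<^esub> p) \<and> P (Rel +>\<^bsub>T\<^esub> (- p))"
  proof (rule free_Abelian_group_induct[of p "carrier F \<times> L"])
    show "Poly_Mapping.keys p \<subseteq> carrier F \<times> L"
      using p by (simp add: formal_tensors_simps)
    have "P (Rel +>\<^bsub>T\<^esub> 0)"
      using pure[of \<zero> 0] pure_zero_right[of \<zero>] Q.a_coset_add_zero[OF Q.a_subset] zero_in_L
      by (simp add: base_change_def Q.quotient_zero formal_tensors_simps(2))
    then show "P (Rel +>\<^bsub>T\<^esub> 0) \<and> P (Rel +>\<^bsub>T\<^esub> (- 0))"
      by simp
  next
    fix q r assume *: "Poly_Mapping.keys q \<subseteq> carrier F \<times> L" "Poly_Mapping.keys r \<subseteq> carrier F \<times> L"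
      "P (Rel +>\<^bsub>T\<^esub> q) \<and> P (Rel +>\<^bsub>T\<^esub> (- q))" "P (Rel +>\<^bsub>T\<^esub> r) \<and> P (Rel +>\<^bsub>T\<^esub> (- r))"
    then have T: "q \<in> carrier T" "r \<in> carrier T"
      by (simp_all add: formal_tensors_simps)
    then show "P (Rel +>\<^bsub>T\<^esub> (q - r)) \<and> P (Rel +>\<^bsub>T\<^esub> (- (q - r)))"
      using add[OF coset[OF T(1)] coset[OF neg[OF T(2)]]] add[OF coset[OF T(2)] coset[OF neg[OF T(1)]]] *
      by (simp add: N_add neg)
  next
    fix s assume "s \<in> carrier F \<times> L"
    then obtain f x where s: "s = (f, x)" "f \<in> carrier F" "x \<in> L"
      by blast
    have inT: "frag_of s \<in> carrier T"
      using s by (simp add: frag_of_in_T)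
    have "(Rel +>\<^bsub>T\<^esub> (- frag_of s)) \<oplus>\<^bsub>N\<^esub> (f \<otimes>\<^sub>t x) = \<zero>\<^bsub>N\<^esub>"
      using inT neg[OF inT] Q.a_coset_add_zero[OF Q.a_subset] unfolding pure_def s(1)
      by (simp add: N_add) (simp add: base_change_def Q.quotient_zero formal_tensors_simps(2))
    then have "Rel +>\<^bsub>T\<^esub> (- frag_of s) = (\<ominus> f) \<otimes>\<^sub>t x"
      using s inT N.minus_equality[of "Rel +>\<^bsub>T\<^esub> (- frag_of s)" "f \<otimes>\<^sub>t x"]
      by (simp add: pure_uminus_left pure_closed coset neg)
    then show "P (Rel +>\<^bsub>T\<^esub> frag_of s) \<and> P (Rel +>\<^bsub>T\<^esub> (- frag_of s))"
      using pure[of f x] pure[of "\<ominus> f" x] s by (simp add: pure_def)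
  qed
  then show ?thesis
    using p by simp
qed

text \<open>The map \<open>a \<otimes> b\<close> induced by additive maps \<open>a\<close> of \<open>F\<close> and \<open>b\<close> of \<open>L\<close>. Scalar multiplication is the case
  where \<open>b\<close> is the identity, the group action the case where \<open>a\<close> is.\<close>

lemma coset_map_frag_extend:
  assumes a: "\<And>f. f \<in> carrier F \<Longrightarrow> a f \<in> carrier F"
      "\<And>f g. f \<in> carrier F \<Longrightarrow> g \<in> carrier F \<Longrightarrow> a (f \<oplus> g) = a f \<oplus> a g"
    and b: "\<And>x. x \<in> L \<Longrightarrow> b x \<in> L" "\<And>x y. x \<in> L \<Longrightarrow> y \<in> L \<Longrightarrow> b (x + y) = b x + b y"
  defines "\<Phi> \<equiv> coset_map T Rel (frag_extend (\<lambda>(f, x). frag_of (a f, b x)))"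
  shows "C \<in> carrier N \<Longrightarrow> \<Phi> C \<in> carrier N"
    and "C \<in> carrier N \<Longrightarrow> D \<in> carrier N \<Longrightarrow> \<Phi> (C \<oplus>\<^bsub>N\<^esub> D) = \<Phi> C \<oplus>\<^bsub>N\<^esub> \<Phi> D"
    and "f \<in> carrier F \<Longrightarrow> x \<in> L \<Longrightarrow> \<Phi> (f \<otimes>\<^sub>t x) = a f \<otimes>\<^sub>t b x"
proof -
  let ?E = "frag_extend (\<lambda>(f, x). frag_of (a f, b x))"
  have closed: "?E p \<in> carrier T" if "p \<in> carrier T" for p
  proof -
    have "Poly_Mapping.keys (case s of (f, x) \<Rightarrow> frag_of (a f, b x)) \<subseteq> carrier F \<times> L"
      if "s \<in> Poly_Mapping.keys p" for s
      using that \<open>p \<in> carrier T\<close> a(1) b(1) by (cases s) (auto simp: formal_tensors_simps)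
    then show ?thesis
      unfolding formal_tensors_simps by (intro order_trans[OF keys_frag_extend] UN_least)
  qed
  have rel: "?E p \<in> Rel" if "p \<in> Rel" for p
    using that
  proof (induction rule: tensor_relations_induct)
    case (left f g x)
    then have "frag_of (a f \<oplus> a g, b x) - frag_of (a f, b x) - frag_of (a g, b x) \<in> Rel"
      unfolding tensor_relations_def using a b by (intro group_closure.base) blast
    then show ?case
      using left a by (simp add: frag_extend_diff)
  next
    case (right f x y)
    then have "frag_of (a f, b x + b y) - frag_of (a f, b x) - frag_of (a f, b y) \<in> Rel"
      unfolding tensor_relations_def using a b by (intro group_closure.base) blast
    then show ?case
      using right b by (simp add: frag_extend_diff)
  next
    case (diff p q)
    then show ?case
      unfolding frag_extend_diff by (simp add: tensor_relations_def group_closure.diff)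
  qed
  have coset: "\<Phi> (Rel +>\<^bsub>T\<^esub> p) = Rel +>\<^bsub>T\<^esub> ?E p" if "p \<in> carrier T" for p
    unfolding \<Phi>_def using that
    by (intro Q.coset_map_rcos) (auto simp: closed rel formal_tensors_simps(3) frag_extend_add)
  show "\<Phi> C \<in> carrier N" if "C \<in> carrier N"
    using that unfolding base_change_def
    by (elim Q.quotient_cases) (simp add: coset closed Q.rcos_in_quotient)
  show "\<Phi> (C \<oplus>\<^bsub>N\<^esub> D) = \<Phi> C \<oplus>\<^bsub>N\<^esub> \<Phi> D" if C: "C \<in> carrier N" and D: "D \<in> carrier N"
  proof -
    obtain p where p: "p \<in> carrier T" "C = Rel +>\<^bsub>T\<^esub> p"
      using C by (rule base_change_cases)
    obtain q where q: "q \<in> carrier T" "D = Rel +>\<^bsub>T\<^esub> q"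
      using D by (rule base_change_cases)
    show ?thesis
      using p q Q.add.m_closed[of p q]
      by (simp add: N_add coset closed formal_tensors_simps(3) frag_extend_add)
  qed
  show "\<Phi> (f \<otimes>\<^sub>t x) = a f \<otimes>\<^sub>t b x" if "f \<in> carrier F" "x \<in> L"
    unfolding pure_def using that by (simp add: coset frag_of_in_T)
qed

lemma base_change_smult:
  "r \<odot>\<^bsub>N\<^esub> C = coset_map T Rel (frag_extend (\<lambda>(f, x). frag_of (r \<otimes> f, x))) C"
  by (simp add: base_change_def quotient_module_def formal_tensors_def)

lemma
  assumes "r \<in> carrier F"
  shows smult_closed_N: "C \<in> carrier N \<Longrightarrow> r \<odot>\<^bsub>N\<^esub> C \<in> carrier N"
    and smult_add_N: "C \<in> carrier N \<Longrightarrow> D \<in> carrier N \<Longrightarrow> r \<odot>\<^bsub>N\<^esub> (C \<oplus>\<^bsub>N\<^esub> D) = r \<odot>\<^bsub>N\<^esub> C \<oplus>\<^bsub>N\<^esub> r \<odot>\<^bsub>N\<^esub> D"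
    and smult_pure: "f \<in> carrier F \<Longrightarrow> x \<in> L \<Longrightarrow> r \<odot>\<^bsub>N\<^esub> (f \<otimes>\<^sub>t x) = (r \<otimes> f) \<otimes>\<^sub>t x"
proof -
  note * = coset_map_frag_extend[of "\<lambda>f. r \<otimes> f" "\<lambda>x. x", folded base_change_smult]
  show "C \<in> carrier N \<Longrightarrow> r \<odot>\<^bsub>N\<^esub> C \<in> carrier N"
    "C \<in> carrier N \<Longrightarrow> D \<in> carrier N \<Longrightarrow> r \<odot>\<^bsub>N\<^esub> (C \<oplus>\<^bsub>N\<^esub> D) = r \<odot>\<^bsub>N\<^esub> C \<oplus>\<^bsub>N\<^esub> r \<odot>\<^bsub>N\<^esub> D"
    "f \<in> carrier F \<Longrightarrow> x \<in> L \<Longrightarrow> r \<odot>\<^bsub>N\<^esub> (f \<otimes>\<^sub>t x) = (r \<otimes> f) \<otimes>\<^sub>t x"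
    by (rule *; use assms in \<open>simp add: r_distr\<close>)+
qed

lemma module_N: "Module.module F N"
proof (rule moduleI)
  fix r s C assume rs: "r \<in> carrier F" "s \<in> carrier F" and "C \<in> carrier N"
  show "(r \<oplus> s) \<odot>\<^bsub>N\<^esub> C = r \<odot>\<^bsub>N\<^esub> C \<oplus>\<^bsub>N\<^esub> s \<odot>\<^bsub>N\<^esub> C"
    using \<open>C \<in> carrier N\<close>
  proof (induction rule: base_change_induct)
    case (pure f x)
    then show ?case using rs by (simp add: smult_pure pure_add_left l_distr)
  next
    case (add C D)
    then show ?case using rs by (simp add: smult_add_N smult_closed_N N.a_ac)
  qed
  show "(r \<otimes> s) \<odot>\<^bsub>N\<^esub> C = r \<odot>\<^bsub>N\<^esub> (s \<odot>\<^bsub>N\<^esub> C)"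
    using \<open>C \<in> carrier N\<close>
  proof (induction rule: base_change_induct)
    case (pure f x)
    then show ?case using rs by (simp add: smult_pure m_assoc)
  next
    case (add C D)
    then show ?case using rs by (simp add: smult_add_N smult_closed_N)
  qed
next
  fix C assume "C \<in> carrier N"
  then show "\<one> \<odot>\<^bsub>N\<^esub> C = C"
    by (induction rule: base_change_induct) (simp_all add: smult_pure smult_add_N)
qed (simp_all add: smult_closed_N smult_add_N abelian_group_N F.cring_axioms)

end

section \<open>The form on an extension of scalars\<close>

text \<open>Only integrality of \<open>\<beta>\<close> makes the floor of \<open>\<beta>\<close>, which enters \<open>formal_form\<close>, biadditive.\<close>

locale scalar_extension_form = scalar_extension F L
  for F :: "('f, 'r) ring_scheme" (structure) and L :: "'v::ab_group_add set" +
  fixes \<beta> :: "'v \<Rightarrow> 'v \<Rightarrow> real"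
  assumes integral: "x \<in> L \<Longrightarrow> y \<in> L \<Longrightarrow> \<beta> x y \<in> \<int>"
    and biadditive_left: "x \<in> L \<Longrightarrow> x' \<in> L \<Longrightarrow> y \<in> L \<Longrightarrow> \<beta> (x + x') y = \<beta> x y + \<beta> x' y"
    and biadditive_right: "x \<in> L \<Longrightarrow> y \<in> L \<Longrightarrow> y' \<in> L \<Longrightarrow> \<beta> x (y + y') = \<beta> x y + \<beta> x y'"
begin

abbreviation \<psi> where "\<psi> \<equiv> formal_form F \<beta>"
abbreviation \<phi> where "\<phi> \<equiv> base_change_form F \<beta>"

lemma floor_left: "x \<in> L \<Longrightarrow> x' \<in> L \<Longrightarrow> y \<in> L \<Longrightarrow> \<lfloor>\<beta> (x + x') y\<rfloor> = \<lfloor>\<beta> x y\<rfloor> + \<lfloor>\<beta> x' y\<rfloor>"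
  using integral[of x y] integral[of x' y] by (auto simp: biadditive_left elim!: Ints_cases)

lemma floor_right: "x \<in> L \<Longrightarrow> y \<in> L \<Longrightarrow> y' \<in> L \<Longrightarrow> \<lfloor>\<beta> x (y + y')\<rfloor> = \<lfloor>\<beta> x y\<rfloor> + \<lfloor>\<beta> x y'\<rfloor>"
  using integral[of x y] integral[of x y'] by (auto simp: biadditive_right elim!: Ints_cases)

lemma add_pow_zero: "add_pow F (0 :: int) x = \<zero>"
  by (simp add: add_pow_def)

lemma double_finsum_add:
  assumes h: "\<And>s t. s \<in> A \<Longrightarrow> t \<in> B \<Longrightarrow> h s t = h\<^sub>1 s t \<oplus> h\<^sub>2 s t"
    and closed: "\<And>s t. s \<in> A \<Longrightarrow> t \<in> B \<Longrightarrow> h\<^sub>1 s t \<in> carrier F"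
      "\<And>s t. s \<in> A \<Longrightarrow> t \<in> B \<Longrightarrow> h\<^sub>2 s t \<in> carrier F"
  shows "(\<Oplus>s\<in>A. \<Oplus>t\<in>B. h s t) = (\<Oplus>s\<in>A. \<Oplus>t\<in>B. h\<^sub>1 s t) \<oplus> (\<Oplus>s\<in>A. \<Oplus>t\<in>B. h\<^sub>2 s t)"
proof -
  have inner: "(\<Oplus>t\<in>B. h s t) = (\<Oplus>t\<in>B. h\<^sub>1 s t) \<oplus> (\<Oplus>t\<in>B. h\<^sub>2 s t)" if "s \<in> A" for s
  proof -
    have "(\<Oplus>t\<in>B. h s t) = (\<Oplus>t\<in>B. h\<^sub>1 s t \<oplus> h\<^sub>2 s t)"
      by (rule add.finprod_cong') (use that closed h in auto)
    also have "\<dots> = (\<Oplus>t\<in>B. h\<^sub>1 s t) \<oplus> (\<Oplus>t\<in>B. h\<^sub>2 s t)"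
      by (rule add.finprod_multf) (use that closed in auto)
    finally show ?thesis .
  qed
  have "(\<Oplus>s\<in>A. \<Oplus>t\<in>B. h s t) = (\<Oplus>s\<in>A. (\<Oplus>t\<in>B. h\<^sub>1 s t) \<oplus> (\<Oplus>t\<in>B. h\<^sub>2 s t))"
    by (rule add.finprod_cong') (use closed inner in \<open>auto intro!: add.finprod_closed add.m_closed\<close>)
  also have "\<dots> = (\<Oplus>s\<in>A. \<Oplus>t\<in>B. h\<^sub>1 s t) \<oplus> (\<Oplus>s\<in>A. \<Oplus>t\<in>B. h\<^sub>2 s t)"
    by (rule add.finprod_multf) (use closed in \<open>auto intro!: add.finprod_closed\<close>)
  finally show ?thesis .
qed

text \<open>Terms outside the supports vanish. Summing over a common finite set of indices makes the
  form additive in each argument, although the support of a sum may be smaller than the union of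
  the supports.\<close>

lemma formal_form_superset:
  assumes A: "finite A" "Poly_Mapping.keys p \<subseteq> A" "A \<subseteq> carrier F \<times> L"
    and B: "finite B" "Poly_Mapping.keys q \<subseteq> B" "B \<subseteq> carrier F \<times> L"
  shows "\<psi> p q = (\<Oplus>s\<in>A. \<Oplus>t\<in>B.
    add_pow F (Poly_Mapping.lookup p s * Poly_Mapping.lookup q t * \<lfloor>\<beta> (snd s) (snd t)\<rfloor>) (fst s \<otimes> fst t))"
proof -
  let ?m = "\<lambda>s t. add_pow F (Poly_Mapping.lookup p s * Poly_Mapping.lookup q t * \<lfloor>\<beta> (snd s) (snd t)\<rfloor>) (fst s \<otimes> fst t)"
  have m: "?m s t \<in> carrier F" if "s \<in> A" "t \<in> B" for s t
    using subsetD[OF A(3) that(1)] subsetD[OF B(3) that(2)] by (auto intro!: add.int_pow_closed)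
  have inner: "(\<Oplus>t\<in>Poly_Mapping.keys q. ?m s t) = (\<Oplus>t\<in>B. ?m s t)" if "s \<in> A" for s
    by (rule add.finprod_mono_neutral_cong_left)
      (use B m that in \<open>auto simp: in_keys_iff add_pow_zero\<close>)
  have "\<psi> p q = (\<Oplus>s\<in>Poly_Mapping.keys p. \<Oplus>t\<in>B. ?m s t)"
    unfolding formal_form_def
    by (rule add.finprod_cong') (use A inner m in \<open>auto intro!: add.finprod_closed\<close>)
  also have "\<dots> = (\<Oplus>s\<in>A. \<Oplus>t\<in>B. ?m s t)"
    by (rule add.finprod_mono_neutral_cong_left)
      (use A m in \<open>auto simp: in_keys_iff add_pow_zero add.finprod_one_eqI intro!: add.finprod_closed\<close>)
  finally show ?thesis .
qed

lemma formal_form_closed: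
  assumes "p \<in> carrier T" "q \<in> carrier T"
  shows "\<psi> p q \<in> carrier F"
  unfolding formal_form_def
proof (intro add.finprod_closed Pi_I add.int_pow_closed)
  fix s t assume "s \<in> Poly_Mapping.keys p" "t \<in> Poly_Mapping.keys q"
  then have "s \<in> carrier F \<times> L" "t \<in> carrier F \<times> L"
    using assms by (auto simp: formal_tensors_simps)
  then show "fst s \<otimes> fst t \<in> carrier F"
    by auto
qed

lemma
  assumes p: "p \<in> carrier T" and p': "p' \<in> carrier T" and q: "q \<in> carrier T"
  shows formal_form_add_left: "\<psi> (p + p') q = \<psi> p q \<oplus> \<psi> p' q"
    and formal_form_add_right: "\<psi> q (p + p') = \<psi> q p \<oplus> \<psi> q p'"
proof -
  let ?A = "Poly_Mapping.keys p \<union> Poly_Mapping.keys p'" and ?B = "Poly_Mapping.keys q"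
  let ?e = "\<lambda>s t. fst s \<otimes> fst t"
  have A: "finite ?A" "?A \<subseteq> carrier F \<times> L" and B: "finite ?B" "?B \<subseteq> carrier F \<times> L"
    using p p' q by (simp_all add: formal_tensors_simps)
  have e: "?e s t \<in> carrier F" "?e t s \<in> carrier F" if "s \<in> ?A" "t \<in> ?B" for s t
    using subsetD[OF A(2) that(1)] subsetD[OF B(2) that(2)] by auto
  note sup = formal_form_superset[OF A(1) _ A(2) B(1) _ B(2)]
    formal_form_superset[OF B(1) _ B(2) A(1) _ A(2)]
  have keys: "Poly_Mapping.keys (p + p') \<subseteq> ?A"
    by (rule keys_add)
  show "\<psi> (p + p') q = \<psi> p q \<oplus> \<psi> p' q"
    unfolding sup(1)[OF keys order.refl] sup(1)[OF Un_upper1 order.refl] sup(1)[OF Un_upper2 order.refl]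
    by (rule double_finsum_add)
      (use e in \<open>auto simp: Poly_Mapping.lookup_add distrib_right add.int_pow_mult add.int_pow_closed\<close>)
  show "\<psi> q (p + p') = \<psi> q p \<oplus> \<psi> q p'"
    unfolding sup(2)[OF order.refl keys] sup(2)[OF order.refl Un_upper1] sup(2)[OF order.refl Un_upper2]
    by (rule double_finsum_add)
      (use e in \<open>auto simp: Poly_Mapping.lookup_add distrib_right distrib_left add.int_pow_mult add.int_pow_closed\<close>)
qed

lemma formal_form_frag_of:
  assumes "f \<in> carrier F" "g \<in> carrier F"
  shows "\<psi> (frag_of (f, x)) (frag_of (g, y)) = add_pow F \<lfloor>\<beta> x y\<rfloor> (f \<otimes> g)"
  using assms by (simp add: formal_form_def add.int_pow_closed)

lemma formal_form_zero:
  assumes "q \<in> carrier T"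
  shows "\<psi> 0 q = \<zero>" "\<psi> q 0 = \<zero>"
  by (simp_all add: formal_form_def add.finprod_one_eqI)

lemma formal_form_uminus:
  assumes "p \<in> carrier T" "q \<in> carrier T"
  shows "\<psi> (- p) q = \<ominus> \<psi> p q" "\<psi> q (- p) = \<ominus> \<psi> q p"
proof -
  have p: "- p \<in> carrier T"
    using assms by (simp add: formal_tensors_simps)
  show "\<psi> (- p) q = \<ominus> \<psi> p q"
    using formal_form_add_left[OF p assms] formal_form_zero[OF assms(2)]
    by (intro minus_equality[symmetric]) (simp_all add: formal_form_closed assms p)
  show "\<psi> q (- p) = \<ominus> \<psi> q p"
    using formal_form_add_right[OF p assms] formal_form_zero[OF assms(2)]
    by (intro minus_equality[symmetric]) (simp_all add: formal_form_closed assms p)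
qed

lemma formal_form_diff:
  assumes "p \<in> carrier T" "p' \<in> carrier T" "q \<in> carrier T"
  shows "\<psi> (p - p') q = \<psi> p q \<ominus> \<psi> p' q" "\<psi> q (p - p') = \<psi> q p \<ominus> \<psi> q p'"
proof -
  have p': "- p' \<in> carrier T"
    using assms by (simp add: formal_tensors_simps)
  show "\<psi> (p - p') q = \<psi> p q \<ominus> \<psi> p' q" "\<psi> q (p - p') = \<psi> q p \<ominus> \<psi> q p'"
    using formal_form_add_left[OF assms(1) p' assms(3)] formal_form_add_right[OF assms(1) p' assms(3)]
      formal_form_uminus[OF assms(2,3)]
    by (simp_all add: a_minus_def)
qed

lemma formal_tensors_induct [consumes 1, case_names frag_of diff]:
  assumes "p \<in> carrier T"
    and "\<And>f x. f \<in> carrier F \<Longrightarrow> x \<in> L \<Longrightarrow> P (frag_of (f, x))"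
    and diff: "\<And>p q. p \<in> carrier T \<Longrightarrow> q \<in> carrier T \<Longrightarrow> P p \<Longrightarrow> P q \<Longrightarrow> P (p - q)"
  shows "P p"
proof (rule free_Abelian_group_induct[of p "carrier F \<times> L"])
  show "P 0"
    using diff[of "frag_of (\<zero>, 0)" "frag_of (\<zero>, 0)"] assms(2)[of \<zero> 0] zero_in_L
    by (simp add: frag_of_in_T)
qed (use assms in \<open>auto simp: formal_tensors_simps\<close>)

text \<open>By additivity a relation need only be tested against the generators.\<close>

lemma formal_form_vanishes:
  assumes r: "r \<in> carrier T" and q: "q \<in> carrier T"
    and "\<And>h y. h \<in> carrier F \<Longrightarrow> y \<in> L \<Longrightarrow> \<psi> r (frag_of (h, y)) = \<zero> \<and> \<psi> (frag_of (h, y)) r = \<zero>"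
  shows "\<psi> r q = \<zero> \<and> \<psi> q r = \<zero>"
  using q by (induction rule: formal_tensors_induct) (use assms in \<open>auto simp: formal_form_diff a_minus_def\<close>)

lemma add_minus_minus: "u \<in> carrier F \<Longrightarrow> v \<in> carrier F \<Longrightarrow> u \<oplus> v \<ominus> u \<ominus> v = \<zero>"
  by (subst a_comm) (simp_all add: a_minus_def a_assoc r_neg)

lemma formal_form_relation:
  assumes "p \<in> Rel" "q \<in> carrier T"
  shows "\<psi> p q = \<zero> \<and> \<psi> q p = \<zero>"
  using assms
proof (induction p arbitrary: q rule: tensor_relations_induct)
  case (left f g x)
  let ?r = "frag_of (f \<oplus> g, x) - frag_of (f, x) - frag_of (g, x)"
  have r: "?r \<in> carrier T" "frag_of (f \<oplus> g, x) - frag_of (f, x) \<in> carrier T"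
    using left unfolding formal_tensors_simps
    by (intro order_trans[OF keys_diff] Un_least; auto)+
  have "\<psi> ?r (frag_of (h, y)) = \<zero> \<and> \<psi> (frag_of (h, y)) ?r = \<zero>" if "h \<in> carrier F" "y \<in> L" for h y
    using that left(1-3) r(2)
    by (simp add: formal_form_diff formal_form_frag_of frag_of_in_T l_distr r_distr
        add.int_pow_distrib add.int_pow_closed add_minus_minus)
  then show ?case
    by (rule formal_form_vanishes[OF r(1) left(4)])
next
  case (right f x y)
  let ?r = "frag_of (f, x + y) - frag_of (f, x) - frag_of (f, y)"
  have r: "?r \<in> carrier T" "frag_of (f, x + y) - frag_of (f, x) \<in> carrier T"
    using right unfolding formal_tensors_simps
    by (intro order_trans[OF keys_diff] Un_least; auto simp: add_in_L)+
  have "\<psi> ?r (frag_of (h, z)) = \<zero> \<and> \<psi> (frag_of (h, z)) ?r = \<zero>" if "h \<in> carrier F" "z \<in> L" for h z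
    using that right(1-3) r(2)
    by (simp add: formal_form_diff formal_form_frag_of frag_of_in_T floor_left floor_right add_in_L
        add.int_pow_mult add.int_pow_closed add_minus_minus)
  then show ?case
    by (rule formal_form_vanishes[OF r(1) right(4)])
next
  case (diff p p')
  then show ?case
    by (simp add: formal_form_diff tensor_relations_subset a_minus_def)
qed

lemma base_change_form_rcos:
  assumes p: "p \<in> carrier T" and q: "q \<in> carrier T"
  shows "\<phi> (Rel +>\<^bsub>T\<^esub> p) (Rel +>\<^bsub>T\<^esub> q) = \<psi> p q"
proof -
  have *: "\<psi> p' q' = \<psi> p q" if p': "p' \<in> Rel +>\<^bsub>T\<^esub> p" and q': "q' \<in> Rel +>\<^bsub>T\<^esub> q" for p' q'
  proof -
    obtain h k where hk: "h \<in> Rel" "p' = h + p" "k \<in> Rel" "q' = k + q"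
      using p' q' by (auto simp: a_r_coset_def' formal_tensors_simps(3))
    have "k + q \<in> carrier T"
      using Q.add.m_closed[of k q] hk q by (simp add: formal_tensors_simps(3) tensor_relations_subset)
    then show ?thesis
      using hk p q by (simp add: formal_form_add_left formal_form_add_right formal_form_closed
          tensor_relations_subset formal_form_relation)
  qed
  show ?thesis
    unfolding base_change_form_def
  proof (rule the_equality)
    show "r = \<psi> p q" if "\<forall>p\<in>Rel +>\<^bsub>T\<^esub> p. \<forall>q\<in>Rel +>\<^bsub>T\<^esub> q. \<psi> p q = r" for r
      using bspec[OF bspec[OF that Q.a_rcos_self[OF p]] Q.a_rcos_self[OF q]] by simp
  qed (use * in blast)
qed

lemma form_pure:
  assumes "f \<in> carrier F" "g \<in> carrier F" "x \<in> L" "y \<in> L"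
  shows "\<phi> (f \<otimes>\<^sub>t x) (g \<otimes>\<^sub>t y) = add_pow F \<lfloor>\<beta> x y\<rfloor> (f \<otimes> g)"
  using assms by (simp add: pure_def base_change_form_rcos frag_of_in_T formal_form_frag_of)

lemma base_change_form_closed:
  assumes "C \<in> carrier N" "D \<in> carrier N"
  shows "\<phi> C D \<in> carrier F"
  using assms by (elim base_change_cases) (simp add: base_change_form_rcos formal_form_closed)

lemma
  assumes C: "C \<in> carrier N" and C': "C' \<in> carrier N" and D: "D \<in> carrier N"
  shows base_change_form_add_left: "\<phi> (C \<oplus>\<^bsub>N\<^esub> C') D = \<phi> C D \<oplus> \<phi> C' D"
    and base_change_form_add_right: "\<phi> D (C \<oplus>\<^bsub>N\<^esub> C') = \<phi> D C \<oplus> \<phi> D C'"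
proof -
  obtain p where p: "p \<in> carrier T" "C = Rel +>\<^bsub>T\<^esub> p"
    using C by (rule base_change_cases)
  obtain p' where p': "p' \<in> carrier T" "C' = Rel +>\<^bsub>T\<^esub> p'"
    using C' by (rule base_change_cases)
  obtain q where q: "q \<in> carrier T" "D = Rel +>\<^bsub>T\<^esub> q"
    using D by (rule base_change_cases)
  have "p + p' \<in> carrier T"
    using Q.add.m_closed[of p p'] p p' by (simp add: formal_tensors_simps(3))
  then show "\<phi> (C \<oplus>\<^bsub>N\<^esub> C') D = \<phi> C D \<oplus> \<phi> C' D"
    "\<phi> D (C \<oplus>\<^bsub>N\<^esub> C') = \<phi> D C \<oplus> \<phi> D C'"
    using p p' q by (simp_all add: N_add base_change_form_rcos formal_form_closed
        formal_form_add_left formal_form_add_right)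
qed

lemma
  assumes r: "r \<in> carrier F" and C: "C \<in> carrier N" and D: "D \<in> carrier N"
  shows base_change_form_smult_left: "\<phi> (r \<odot>\<^bsub>N\<^esub> C) D = r \<otimes> \<phi> C D"
    and base_change_form_smult_right: "\<phi> C (r \<odot>\<^bsub>N\<^esub> D) = r \<otimes> \<phi> C D"
proof -
  have "\<phi> (r \<odot>\<^bsub>N\<^esub> C) D = r \<otimes> \<phi> C D \<and> \<phi> C (r \<odot>\<^bsub>N\<^esub> D) = r \<otimes> \<phi> C D"
    using C
  proof (induction rule: base_change_induct)
    case (pure f x)
    show ?case
      using D
    proof (induction rule: base_change_induct)
      case (pure g y)
      then show ?case
        using r \<open>f \<in> carrier F\<close> \<open>x \<in> L\<close>
        by (simp add: smult_pure form_pure add_pow_rdistr_int m_ac)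
    next
      case (add D D')
      then show ?case
        using r \<open>f \<in> carrier F\<close> \<open>x \<in> L\<close>
        by (simp add: smult_add_N smult_closed_N base_change_form_add_right
            base_change_form_closed pure_closed r_distr)
    qed
  next
    case (add C C')
    then show ?case
      using r D by (simp add: smult_add_N smult_closed_N base_change_form_add_left
            base_change_form_closed r_distr)
  qed
  then show "\<phi> (r \<odot>\<^bsub>N\<^esub> C) D = r \<otimes> \<phi> C D" "\<phi> C (r \<odot>\<^bsub>N\<^esub> D) = r \<otimes> \<phi> C D"
    by simp_all
qed

end

section \<open>Lattices with a group action and an invariant form\<close>

text \<open>A lattice on which \<open>G\<close> acts by isometries of an integral form. Its extensions of scalars are
  modules with an invariant form.\<close>

locale equivariant_lattice = scalar_extension_form F L \<beta> + G?: group G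
  for F :: "('f, 'r) ring_scheme" (structure) and L :: "'v::ab_group_add set" and \<beta>
    and G :: "('g, 'm) monoid_scheme" (structure) +
  fixes \<rho> :: "'g \<Rightarrow> 'v \<Rightarrow> 'v"
  assumes L_closed: "g \<in> carrier G \<Longrightarrow> x \<in> L \<Longrightarrow> \<rho> g x \<in> L"
    and L_add: "g \<in> carrier G \<Longrightarrow> x \<in> L \<Longrightarrow> y \<in> L \<Longrightarrow> \<rho> g (x + y) = \<rho> g x + \<rho> g y"
    and L_one: "x \<in> L \<Longrightarrow> \<rho> \<one>\<^bsub>G\<^esub> x = x"
    and L_mult: "g \<in> carrier G \<Longrightarrow> h \<in> carrier G \<Longrightarrow> x \<in> L \<Longrightarrow> \<rho> (g \<otimes>\<^bsub>G\<^esub> h) x = \<rho> g (\<rho> h x)"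
    and L_form: "g \<in> carrier G \<Longrightarrow> x \<in> L \<Longrightarrow> y \<in> L \<Longrightarrow> \<beta> (\<rho> g x) (\<rho> g y) = \<beta> x y"
begin

abbreviation \<sigma> where "\<sigma> \<equiv> base_change_act F L \<rho>"

lemma
  assumes "g \<in> carrier G"
  shows base_change_act_closed: "C \<in> carrier N \<Longrightarrow> \<sigma> g C \<in> carrier N"
    and base_change_act_add: "C \<in> carrier N \<Longrightarrow> D \<in> carrier N \<Longrightarrow> \<sigma> g (C \<oplus>\<^bsub>N\<^esub> D) = \<sigma> g C \<oplus>\<^bsub>N\<^esub> \<sigma> g D"
    and base_change_act_pure: "f \<in> carrier F \<Longrightarrow> x \<in> L \<Longrightarrow> \<sigma> g (f \<otimes>\<^sub>t x) = f \<otimes>\<^sub>t \<rho> g x"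
proof -
  note * = coset_map_frag_extend[of "\<lambda>f. f" "\<rho> g", folded base_change_act_def]
  show "C \<in> carrier N \<Longrightarrow> \<sigma> g C \<in> carrier N"
    "C \<in> carrier N \<Longrightarrow> D \<in> carrier N \<Longrightarrow> \<sigma> g (C \<oplus>\<^bsub>N\<^esub> D) = \<sigma> g C \<oplus>\<^bsub>N\<^esub> \<sigma> g D"
    "f \<in> carrier F \<Longrightarrow> x \<in> L \<Longrightarrow> \<sigma> g (f \<otimes>\<^sub>t x) = f \<otimes>\<^sub>t \<rho> g x"
    by (rule *; use assms in \<open>simp add: L_closed L_add\<close>)+
qed

lemma group_module_base_change: "group_module F G N \<sigma>"
  unfolding group_module_def
proof (intro conjI)
  show "group_module_axioms F G N \<sigma>"
  proof
    fix C assume "C \<in> carrier N"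
    then show "\<sigma> \<one>\<^bsub>G\<^esub> C = C"
      by (induction rule: base_change_induct)
        (simp_all add: base_change_act_pure base_change_act_add L_one)
  next
    fix g h C assume "g \<in> carrier G" "h \<in> carrier G" and C: "C \<in> carrier N"
    from C show "\<sigma> (g \<otimes>\<^bsub>G\<^esub> h) C = \<sigma> g (\<sigma> h C)"
      by (induction rule: base_change_induct)
        (simp_all add: \<open>g \<in> carrier G\<close> \<open>h \<in> carrier G\<close> base_change_act_pure base_change_act_add
          base_change_act_closed L_mult L_closed)
  next
    fix g r C assume "g \<in> carrier G" "r \<in> carrier F" and C: "C \<in> carrier N"
    from C show "\<sigma> g (r \<odot>\<^bsub>N\<^esub> C) = r \<odot>\<^bsub>N\<^esub> \<sigma> g C"
      by (induction rule: base_change_induct)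
        (simp_all add: \<open>g \<in> carrier G\<close> \<open>r \<in> carrier F\<close> base_change_act_pure base_change_act_add
          base_change_act_closed smult_pure smult_add_N smult_closed_N L_closed)
  qed (simp_all add: base_change_act_closed base_change_act_add)
qed (rule module_N G.group_axioms)+

lemma base_change_form_act:
  assumes g: "g \<in> carrier G" and C: "C \<in> carrier N" and D: "D \<in> carrier N"
  shows "\<phi> (\<sigma> g C) (\<sigma> g D) = \<phi> C D"
  using C
proof (induction rule: base_change_induct)
  case (pure f x)
  show ?case
    using D
    by (induction rule: base_change_induct)
      (simp_all add: g pure base_change_act_pure base_change_act_add base_change_act_closed L_closed
        form_pure L_form pure_closed base_change_form_add_right)
next
  case (add C C')
  then show ?case
    by (simp add: g D base_change_act_add base_change_act_closed base_change_form_add_left)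
qed

sublocale I: invariant_form F G N \<sigma> \<phi>
  unfolding invariant_form_def
proof
  show "invariant_form_axioms F G N \<sigma> \<phi>"
    by unfold_locales (simp_all add: base_change_form_closed base_change_form_add_left
        base_change_form_add_right base_change_form_smult_left base_change_form_smult_right
        base_change_form_act)
qed (rule group_module_base_change)

text \<open>The additive map \<open>\<mu>\<close> of the integers is \<open>n \<mapsto> n s\<close> for \<open>s = \<mu> 1\<close>; integer multiples are expressed in
  this way because \<open>L\<close> lies in an arbitrary abelian group.\<close>

lemma pure_int_multiple:
  assumes add: "\<And>i j. \<mu> (i + j) = \<mu> i + \<mu> j" and 1: "\<mu> (1 :: int) \<in> L" and f: "f \<in> carrier F"
  shows "\<mu> n \<in> L \<and> f \<otimes>\<^sub>t \<mu> n = add_pow F n f \<otimes>\<^sub>t \<mu> 1"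
proof (induction n rule: int_induct[where k = 0])
  case base
  have "\<mu> 0 = 0"
    using add[of 0 0] by simp
  then show ?case
    using 1 f by (simp add: zero_in_L add_pow_zero pure_zero_left pure_zero_right)
next
  case (step1 i)
  then show ?case
    using 1 f by (simp add: add add_in_L pure_add_right add.int_pow_mult pure_add_left add.int_pow_closed)
next
  case (step2 i)
  have "\<mu> (i - 1) = \<mu> i - \<mu> 1"
    using add[of "i - 1" 1] by simp
  moreover have "add_pow F (i - 1) f = add_pow F i f \<oplus> \<ominus> f"
    using f by (simp add: add.int_pow_diff a_minus_def)
  ultimately show ?case
    using 1 f step2
    by (simp add: diff_in_L pure_diff pure_add_left pure_uminus_left add.int_pow_closed a_minus_def)
qed

text \<open>The identity \<open>(1 - g) (1 - h) x = \<beta>(x, s) s\<close> on \<open>L\<close> implies the same identity on \<open>F \<otimes> L\<close>, since both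
  sides are additive and agree on pure tensors.\<close>

lemma rank_one_operator:
  assumes g: "g \<in> carrier G" and h: "h \<in> carrier G"
    and \<mu>: "\<And>i j. \<mu> (i + j) = \<mu> i + \<mu> j" "\<mu> (1 :: int) = s" and s: "s \<in> L"
    and op: "\<And>x. x \<in> L \<Longrightarrow> x - \<rho> g x - \<rho> h x + \<rho> g (\<rho> h x) = \<mu> \<lfloor>\<beta> x s\<rfloor>"
    and C: "C \<in> carrier N"
  shows "\<phi> C (\<one> \<otimes>\<^sub>t s) \<odot>\<^bsub>N\<^esub> (\<one> \<otimes>\<^sub>t s) =
    C \<ominus>\<^bsub>N\<^esub> \<sigma> g C \<ominus>\<^bsub>N\<^esub> \<sigma> h C \<oplus>\<^bsub>N\<^esub> \<sigma> g (\<sigma> h C)"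
  using C
proof (induction rule: base_change_induct)
  case (pure f x)
  let ?C = "f \<otimes>\<^sub>t x"
  have "?C \<ominus>\<^bsub>N\<^esub> \<sigma> g ?C \<ominus>\<^bsub>N\<^esub> \<sigma> h ?C \<oplus>\<^bsub>N\<^esub> \<sigma> g (\<sigma> h ?C) = f \<otimes>\<^sub>t (x - \<rho> g x - \<rho> h x + \<rho> g (\<rho> h x))"
    using pure g h by (simp add: base_change_act_pure L_closed pure_add_right pure_diff diff_in_L)
  also have "x - \<rho> g x - \<rho> h x + \<rho> g (\<rho> h x) = \<mu> \<lfloor>\<beta> x s\<rfloor>"
    by (rule op[OF pure(2)])
  also have "f \<otimes>\<^sub>t \<mu> \<lfloor>\<beta> x s\<rfloor> = add_pow F \<lfloor>\<beta> x s\<rfloor> f \<otimes>\<^sub>t s"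
    using pure_int_multiple[of \<mu> f, OF \<mu>(1) _ pure(1)] \<mu>(2) s by simp
  also have "\<dots> = \<phi> (f \<otimes>\<^sub>t x) (\<one> \<otimes>\<^sub>t s) \<odot>\<^bsub>N\<^esub> (\<one> \<otimes>\<^sub>t s)"
    using pure s by (simp add: form_pure smult_pure add.int_pow_closed)
  finally show ?case by simp
next
  case (add C D)
  have cl: "\<phi> C (\<one> \<otimes>\<^sub>t s) \<in> carrier F" "\<phi> D (\<one> \<otimes>\<^sub>t s) \<in> carrier F" "\<one> \<otimes>\<^sub>t s \<in> carrier N"
    using add s by (simp_all add: base_change_form_closed pure_closed)
  show ?case
    using add cl g h
    by (simp add: base_change_form_add_left I.smult_l_distr base_change_act_add base_change_act_closed
        a_minus_def N.minus_add N.a_ac)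
qed

text \<open>The abstract form of the argument: vectors \<open>s\<close> from one orbit span the lattice, and each of
  the operators \<open>x \<mapsto> \<beta>(x, s) s\<close> is the action of an element \<open>(1 - g) (1 - h)\<close> of the group ring.\<close>

lemma radical_largest_proper_submodule:
  assumes field: "field F"
    and S: "L = group_closure S"
    and transitive: "\<And>s t. s \<in> S \<Longrightarrow> t \<in> S \<Longrightarrow> \<exists>g\<in>carrier G. \<rho> g s = t"
    and rank_one: "\<And>s. s \<in> S \<Longrightarrow> \<exists>g\<in>carrier G. \<exists>h\<in>carrier G. \<exists>\<mu> :: int \<Rightarrow> 'v.
      (\<forall>i j. \<mu> (i + j) = \<mu> i + \<mu> j) \<and> \<mu> 1 = s \<and>
      (\<forall>x\<in>L. x - \<rho> g x - \<rho> h x + \<rho> g (\<rho> h x) = \<mu> \<lfloor>\<beta> x s\<rfloor>)"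
    and K: "group_submodule F G N \<sigma> K"
  shows "K \<subseteq> radical F N \<phi> \<or> K = carrier N"
proof (rule I.submodule_in_radical_or_full[OF field _ _ _ _ K])
  have SL: "S \<subseteq> L"
    unfolding S by (auto intro: group_closure.base)
  show "(\<lambda>s. \<one> \<otimes>\<^sub>t s) ` S \<subseteq> carrier N"
    using SL by (auto intro: pure_closed)
next
  have SL: "S \<subseteq> L"
    unfolding S by (auto intro: group_closure.base)
  fix K assume K: "submodule K F N" "(\<lambda>s. \<one> \<otimes>\<^sub>t s) ` S \<subseteq> K"
  note K' = I.submoduleE[OF K(1)]
  have zero: "\<zero>\<^bsub>N\<^esub> \<in> K"
    using subgroup.one_closed[OF submodule.axioms(1)[OF K(1)]] by simp
  have pure: "f \<otimes>\<^sub>t x \<in> K" if f: "f \<in> carrier F" and x: "x \<in> L" for f x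
    using x[unfolded S]
  proof (induction rule: group_closure.induct)
    case (base s)
    show ?case
    proof (cases "s = 0")
      case True
      then show ?thesis
        using f zero by (simp add: pure_zero_right)
    next
      case False
      then have s: "s \<in> S"
        using base by simp
      then have "f \<odot>\<^bsub>N\<^esub> (\<one> \<otimes>\<^sub>t s) \<in> K"
        using K(2) K'(4) f by blast
      then show ?thesis
        using f s SL by (simp add: smult_pure subsetD)
    qed
  next
    case (diff x y)
    then have L: "x \<in> L" "y \<in> L"
      by (simp_all add: S)
    then show ?case
      using diff.IH K'(3,5) f by (simp add: pure_diff a_minus_def)
  qed
  have "C \<in> K" if "C \<in> carrier N" for C
    using that by (induction rule: base_change_induct) (simp_all add: pure K'(5))
  then show "K = carrier N"
    using K'(1) by blast
next
  have SL: "S \<subseteq> L"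
    unfolding S by (auto intro: group_closure.base)
  show "\<exists>g\<in>carrier G. \<sigma> g s = t" if st: "s \<in> (\<lambda>s. \<one> \<otimes>\<^sub>t s) ` S" "t \<in> (\<lambda>s. \<one> \<otimes>\<^sub>t s) ` S" for s t
  proof -
    obtain s' t' where *: "s = \<one> \<otimes>\<^sub>t s'" "s' \<in> S" "t = \<one> \<otimes>\<^sub>t t'" "t' \<in> S"
      using st by blast
    obtain g where "g \<in> carrier G" "\<rho> g s' = t'"
      using transitive[OF *(2,4)] by blast
    then show ?thesis
      using * SL by (intro bexI[of _ g]) (auto simp: base_change_act_pure)
  qed
  fix K x t
  assume K: "group_submodule F G N \<sigma> K" and x: "x \<in> K" and t: "t \<in> (\<lambda>s. \<one> \<otimes>\<^sub>t s) ` S"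
  obtain s where s: "t = \<one> \<otimes>\<^sub>t s" "s \<in> S"
    using t by blast
  obtain g h \<mu> where gh: "g \<in> carrier G" "h \<in> carrier G"
    and \<mu>: "\<And>i j. \<mu> (i + j) = \<mu> i + \<mu> j" "\<mu> (1 :: int) = s"
    and op: "\<And>x. x \<in> L \<Longrightarrow> x - \<rho> g x - \<rho> h x + \<rho> g (\<rho> h x) = \<mu> \<lfloor>\<beta> x s\<rfloor>"
    using rank_one[OF s(2)] by blast
  have Ks: "submodule K F N" and Ka: "\<And>g x. g \<in> carrier G \<Longrightarrow> x \<in> K \<Longrightarrow> \<sigma> g x \<in> K"
    using K by (auto simp: group_submodule_def)
  note K' = I.submoduleE[OF Ks]
  have "x \<in> carrier N" "s \<in> L"
    using x K'(1) s SL by auto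
  then have "\<phi> x t \<odot>\<^bsub>N\<^esub> t = x \<ominus>\<^bsub>N\<^esub> \<sigma> g x \<ominus>\<^bsub>N\<^esub> \<sigma> h x \<oplus>\<^bsub>N\<^esub> \<sigma> g (\<sigma> h x)"
    unfolding s(1) by (intro rank_one_operator[OF gh \<mu>] op)
  also have "\<dots> \<in> K"
    unfolding a_minus_def by (intro K'(5) K'(3) Ka x gh)
  finally show "\<phi> x t \<odot>\<^bsub>N\<^esub> t \<in> K" .
qed

end

section \<open>Reflections and the symmetric square\<close>

lemma sum_fun_apply: "(\<Sum>a\<in>A. f a) x = (\<Sum>a\<in>A. f a x)"
  by (induction A rule: infinite_finite_induct) auto

lemma scale_apply: "scale r v x = r * v x"
  by (simp add: scale_def)

text \<open>As simplification rules the pointwise laws can turn sums and differences of vectors that are not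
  applied to an argument into abstractions, to which the linearity lemmas below do not apply.
  They are therefore collected for explicit use.\<close>

declare plus_fun_apply [simp del] zero_fun_apply [simp del] minus_apply [simp del]

lemmas pointwise = fun_eq_iff plus_fun_apply zero_fun_apply minus_apply scale_apply sum_fun_apply

locale diagram =
  fixes I :: "vertex set"
  assumes finite_I: "finite I"
begin

abbreviation B where "B \<equiv> bform I"
abbreviation \<alpha> where "\<alpha> \<equiv> simple_root"
abbreviation act where "act \<equiv> word_act I"
abbreviation cls where "cls u \<equiv> coxeter_rel I `` {u}"

text \<open>The span of the simple roots. Since \<open>tensor_act\<close> reads only the coordinates in \<open>I\<close>, it is the
  diagonal action only on tensors of vectors in this span.\<close>

definition V :: "(vertex \<Rightarrow> real) set" where
  "V = {v. \<forall>i. i \<notin> I \<longrightarrow> v i = 0}"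

lemma bform_commute: "B u v = B v u"
proof -
  have "B u v = (\<Sum>j\<in>I. \<Sum>i\<in>I. u i * v j * of_int (cartan i j))"
    unfolding bform_def by (rule sum.swap)
  then show ?thesis
    by (simp add: bform_def cartan_commute mult.commute mult.left_commute)
qed

lemma bform_add_right: "B u (v + w) = B u v + B u w"
  by (simp add: bform_def plus_fun_apply distrib_left distrib_right sum.distrib)

lemma bform_diff_right: "B u (v - w) = B u v - B u w"
  by (simp add: bform_def minus_apply left_diff_distrib right_diff_distrib sum_subtractf)

lemma bform_scale_right: "B u (scale r v) = r * B u v"
  by (simp add: bform_def scale_apply sum_distrib_left mult_ac)

lemma bform_add_left: "B (u + v) w = B u w + B v w"
  and bform_diff_left: "B (u - v) w = B u w - B v w"
  and bform_scale_left: "B (scale r u) w = r * B u w"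
  by (simp_all add: bform_commute[of _ w] bform_add_right bform_diff_right bform_scale_right)

lemmas bform_simps = bform_add_left bform_add_right bform_diff_left bform_diff_right
  bform_scale_left bform_scale_right

lemma bform_reflection:
  assumes "i \<in> I"
  shows "B (reflection I i u) (reflection I i v) = B u v"
proof -
  have "B (\<alpha> i) (\<alpha> i) = 2"
    using finite_I assms by (simp add: bform_simple cartan_def)
  then show ?thesis
    by (simp add: reflection_def bform_simps bform_commute[of u "\<alpha> i"] algebra_simps)
qed

lemma word_act_Nil: "act [] v = v"
  by (simp add: word_act_def)

lemma word_act_Cons: "act (i # u) v = reflection I i (act u v)"
  by (simp add: word_act_def)

lemma word_act_append: "act (u @ u') v = act u (act u' v)"
  by (simp add: word_act_def)

lemma word_act_add: "act u (v + w) = act u v + act u w"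
proof (induction u)
  case (Cons i u)
  then show ?case
    by (simp only: word_act_Cons reflection_def bform_simps) (simp add: pointwise algebra_simps)
qed (simp add: word_act_Nil)

lemma word_act_scale: "act u (scale r v) = scale r (act u v)"
proof (induction u)
  case (Cons i u)
  then show ?case
    by (simp only: word_act_Cons reflection_def bform_simps) (simp add: pointwise algebra_simps)
qed (simp add: word_act_Nil)

lemma word_act_zero: "act u 0 = 0"
  using word_act_add[of u 0 0] by simp

lemma word_act_sum: "act u (\<Sum>a\<in>A. f a) = (\<Sum>a\<in>A. act u (f a))"
  by (induction A rule: infinite_finite_induct)
    (simp_all add: word_act_zero word_act_add)

lemma bform_word_act:
  assumes "u \<in> lists I"
  shows "B (act u v) (act u w) = B v w"
  using assms by (induction u) (simp_all add: word_act_Nil word_act_Cons bform_reflection)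

lemma word_act_rev:
  assumes "u \<in> lists I"
  shows "act (rev u) (act u v) = v" "act u (act (rev u) v) = v"
proof -
  have *: "act (rev u') (act u' v) = v" if "u' \<in> lists I" for u'
    using word_act_coxeter_eq[OF finite_I coxeter_eq_rev[OF that]]
    by (metis word_act_append word_act_Nil)
  show "act (rev u) (act u v) = v"
    by (rule *[OF assms])
  have "rev u \<in> lists I"
    using assms by auto
  then show "act u (act (rev u) v) = v"
    using *[of "rev u"] by simp
qed

lemma simple_root_in_V: "i \<in> I \<Longrightarrow> \<alpha> i \<in> V"
  by (auto simp: V_def simple_root_def)

lemma V_diff: "v \<in> V \<Longrightarrow> w \<in> V \<Longrightarrow> v - w \<in> V"
  and V_scale: "v \<in> V \<Longrightarrow> scale r v \<in> V"
  by (auto simp: V_def pointwise)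

lemma word_act_in_V:
  assumes "u \<in> lists I" "v \<in> V"
  shows "act u v \<in> V"
  using assms by (induction u)
    (simp_all add: word_act_Nil word_act_Cons reflection_def V_diff V_scale simple_root_in_V)

lemma V_expansion:
  assumes "v \<in> V"
  shows "v = (\<Sum>i\<in>I. scale (v i) (\<alpha> i))"
proof
  fix x
  have "(\<Sum>i\<in>I. scale (v i) (\<alpha> i)) x = (\<Sum>i\<in>I. if i = x then v i else 0)"
    unfolding sum_fun_apply by (rule sum.cong) (auto simp: simple_root_def scale_apply)
  then show "v x = (\<Sum>i\<in>I. scale (v i) (\<alpha> i)) x"
    using assms finite_I by (simp add: V_def)
qed

lemma word_act_expansion:
  assumes "v \<in> V"
  shows "act u v x = (\<Sum>i\<in>I. v i * act u (\<alpha> i) x)"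
proof -
  have "act u v = (\<Sum>i\<in>I. scale (v i) (act u (\<alpha> i)))"
    by (subst V_expansion[OF assms]) (simp add: word_act_sum word_act_scale)
  then show ?thesis
    by (simp add: pointwise)
qed

lemma real_roots_iff: "\<beta> \<in> real_roots I \<longleftrightarrow> (\<exists>u\<in>lists I. \<exists>i\<in>I. \<beta> = act u (\<alpha> i))"
proof
  assume "\<beta> \<in> real_roots I"
  then obtain w i where w: "w \<in> carrier (coxeter_group I)" "i \<in> I" "\<beta> = coxeter_act I w (\<alpha> i)"
    by (auto simp: real_roots_def)
  obtain u where "u \<in> lists I" "w = cls u"
    using w(1) by (rule coxeter_group_cases)
  then show "\<exists>u\<in>lists I. \<exists>i\<in>I. \<beta> = act u (\<alpha> i)"
    using w by (auto simp: coxeter_act_class[OF finite_I])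
next
  assume "\<exists>u\<in>lists I. \<exists>i\<in>I. \<beta> = act u (\<alpha> i)"
  then obtain u i where u: "u \<in> lists I" "i \<in> I" "\<beta> = act u (\<alpha> i)"
    by blast
  then have "\<beta> = coxeter_act I (cls u) (\<alpha> i)"
    by (simp add: coxeter_act_class[OF finite_I])
  then show "\<beta> \<in> real_roots I"
    using u coxeter_class_in_carrier unfolding real_roots_def by blast
qed

lemma simple_root_real: "i \<in> I \<Longrightarrow> \<alpha> i \<in> real_roots I"
  unfolding real_roots_iff by (intro bexI[of _ "[]"] bexI[of _ i]) (simp_all add: word_act_Nil)

lemma real_root_act:
  assumes "u \<in> lists I" "\<beta> \<in> real_roots I"
  shows "act u \<beta> \<in> real_roots I"
proof -
  obtain u' i where "u' \<in> lists I" "i \<in> I" "\<beta> = act u' (\<alpha> i)"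
    using assms(2) by (auto simp: real_roots_iff)
  then show ?thesis
    unfolding real_roots_iff using assms(1)
    by (intro bexI[of _ "u @ u'"] bexI[of _ i]) (simp_all add: word_act_append)
qed

lemma real_root_in_V: "\<beta> \<in> real_roots I \<Longrightarrow> \<beta> \<in> V"
  by (auto simp: real_roots_iff intro: word_act_in_V simple_root_in_V)

lemma real_root_norm: "\<beta> \<in> real_roots I \<Longrightarrow> B \<beta> \<beta> = 2"
  unfolding real_roots_iff
  by (elim bexE) (simp only: bform_word_act bform_simple[OF finite_I], simp add: cartan_def)

lemma real_root_integral:
  assumes "\<beta> \<in> real_roots I"
  shows "\<beta> x \<in> \<int>"
proof -
  have "act u (\<alpha> i) x \<in> \<int>" if "u \<in> lists I" "i \<in> I" for u i x
    using that
  proof (induction u arbitrary: x)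
    case Nil
    then show ?case by (simp add: word_act_Nil simple_root_def)
  next
    case (Cons j u)
    then show ?case
      using bform_simple_left[OF finite_I, of j "act u (\<alpha> i)"]
      by (auto simp: word_act_Cons reflection_apply simple_root_def[of j]
          intro!: Ints_diff Ints_sum Ints_mult)
  qed
  then show ?thesis
    using assms by (auto simp: real_roots_iff)
qed

lemma bform_real_roots_integral:
  assumes "\<beta> \<in> real_roots I" "\<gamma> \<in> real_roots I"
  shows "B \<beta> \<gamma> \<in> \<int>"
  unfolding bform_def
  using real_root_integral[OF assms(1)] real_root_integral[OF assms(2)]
  by (intro Ints_sum Ints_mult Ints_of_int) auto

text \<open>The reflection in \<open>\<beta> = u \<alpha>\<^sub>i\<close> is the conjugate of \<open>s\<^sub>i\<close> by \<open>u\<close>.\<close>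

lemma reflection_word:
  assumes "\<beta> \<in> real_roots I"
  shows "\<exists>u\<in>lists I. \<forall>v. act u v = v - scale (B \<beta> v) \<beta>"
proof -
  obtain u i where u: "u \<in> lists I" "i \<in> I" "\<beta> = act u (\<alpha> i)"
    using assms by (auto simp: real_roots_iff)
  have "act (u @ [i] @ rev u) v = v - scale (B \<beta> v) \<beta>" for v
  proof -
    have rev: "rev u \<in> lists I"
      using u by auto
    have "B (\<alpha> i) (act (rev u) v) = B \<beta> v"
      using bform_word_act[OF u(1), of "\<alpha> i" "act (rev u) v"] word_act_rev(2)[OF u(1), of v]
      by (simp add: u(3))
    then have "act ([i] @ rev u) v = act (rev u) v + scale (- B \<beta> v) (\<alpha> i)"
      by (simp add: word_act_Cons reflection_def pointwise)
    then have "act (u @ [i] @ rev u) v = v + scale (- B \<beta> v) \<beta>"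
      by (simp only: word_act_append[of u] word_act_add word_act_scale word_act_rev(2)[OF u(1)] u(3))
    then show ?thesis
      by (simp add: pointwise)
  qed
  moreover have "u @ [i] @ rev u \<in> lists I"
    using u by auto
  ultimately show ?thesis
    by blast
qed

abbreviation tact where "tact \<equiv> tensor_act I"

lemma tensor_act_tensor:
  assumes "u \<in> lists I" "v \<in> V" "w \<in> V"
  shows "tact (cls u) (tensor v w) = tensor (act u v) (act u w)"
proof
  fix xy :: "vertex \<times> vertex"
  obtain x y where xy: "xy = (x, y)" by (cases xy)
  show "tact (cls u) (tensor v w) xy = tensor (act u v) (act u w) xy"
    using assms unfolding xy
    by (simp add: tensor_act_def coxeter_act_class[OF finite_I] pointwise tensor_def
        word_act_expansion[of v] word_act_expansion[of w] sum_product mult_ac)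
qed

lemma tensor_act_add: "tact w (s + t) = tact w s + tact w t"
  by (simp add: pointwise tensor_act_def pointwise distrib_right sum.distrib)

lemma tensor_act_diff: "tact w (s - t) = tact w s - tact w t"
  by (simp add: pointwise tensor_act_def pointwise left_diff_distrib sum_subtractf)

lemma tensor_act_zero: "tact w 0 = 0"
  using tensor_act_add[of w 0 0] by simp

lemma tensor_act_sym_tensor:
  assumes "u \<in> lists I" "v \<in> V" "w \<in> V"
  shows "tact (cls u) (v \<or>\<^sub>s w) = act u v \<or>\<^sub>s act u w"
  using assms by (simp add: sym_tensor_def tensor_act_add tensor_act_tensor)

text \<open>The additive group generated by the products \<open>v \<or> w\<close> is already all of \<open>S\<^sup>2(V)\<close>,
  because scalars can be absorbed into one factor. On \<open>S\<^sup>2(V)\<close> the diagonal action is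
  determined by the action on \<open>V\<close>.\<close>

definition sym_square :: "(vertex \<times> vertex \<Rightarrow> real) set" where
  "sym_square = group_closure {v \<or>\<^sub>s w | v w. v \<in> V \<and> w \<in> V}"

lemma sym_tensor_in_sym_square: "v \<in> V \<Longrightarrow> w \<in> V \<Longrightarrow> v \<or>\<^sub>s w \<in> sym_square"
  unfolding sym_square_def by (intro group_closure.base) blast

lemma sym_square_induct [consumes 1, case_names sym_tensor diff]:
  assumes "t \<in> sym_square"
    and "\<And>v w. v \<in> V \<Longrightarrow> w \<in> V \<Longrightarrow> P (v \<or>\<^sub>s w)"
    and "\<And>s t. s \<in> sym_square \<Longrightarrow> t \<in> sym_square \<Longrightarrow> P s \<Longrightarrow> P t \<Longrightarrow> P (s - t)"
  shows "P t"
proof -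
  have "0 \<in> V" by (simp add: V_def pointwise)
  moreover have "0 \<or>\<^sub>s 0 = (0 :: vertex \<times> vertex \<Rightarrow> real)"
    by (simp add: pointwise sym_tensor_def tensor_def)
  ultimately have "P 0"
    using assms(2)[of 0 0] by simp
  show ?thesis
    using assms(1)[unfolded sym_square_def]
  proof (induction rule: group_closure.induct)
    case (base s)
    then show ?case
      using \<open>P 0\<close> assms(2) by blast
  next
    case (diff s t)
    then show ?case
      using assms(3) by (simp add: sym_square_def)
  qed
qed

lemma tensor_act_mult:
  assumes "g \<in> carrier (coxeter_group I)" "h \<in> carrier (coxeter_group I)" and t: "t \<in> sym_square"
  shows "tact (g \<otimes>\<^bsub>coxeter_group I\<^esub> h) t = tact g (tact h t)"
proof -
  obtain u where u: "u \<in> lists I" "g = cls u"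
    using assms(1) by (rule coxeter_group_cases)
  obtain u' where u': "u' \<in> lists I" "h = cls u'"
    using assms(2) by (rule coxeter_group_cases)
  show ?thesis
    using t
  proof (induction rule: sym_square_induct)
    case (sym_tensor v w)
    have "u @ u' \<in> lists I"
      using u u' by auto
    then show ?case
      using u u' sym_tensor
      by (simp add: coxeter_mult_class tensor_act_sym_tensor word_act_in_V word_act_append del: append_in_lists_conv)
  qed (simp add: tensor_act_diff)
qed

lemma tensor_act_one:
  assumes "t \<in> sym_square"
  shows "tact \<one>\<^bsub>coxeter_group I\<^esub> t = t"
  using assms unfolding coxeter_group_one
  by (induction rule: sym_square_induct) (simp_all add: tensor_act_sym_tensor word_act_Nil tensor_act_diff)

lemma bform2_diff_left: "bform2 I (s - s') t = bform2 I s t - bform2 I s' t"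
  using bform2_add_left[of I "s - s'" s' t] by simp

lemma bform2_diff_right: "bform2 I s (t - t') = bform2 I s t - bform2 I s t'"
  using bform2_add_right[of I s "t - t'" t'] by simp

lemma bform2_tensor_act:
  assumes "g \<in> carrier (coxeter_group I)" and s: "s \<in> sym_square" and t: "t \<in> sym_square"
  shows "bform2 I (tact g s) (tact g t) = bform2 I s t"
proof -
  obtain u where u: "u \<in> lists I" "g = cls u"
    using assms(1) by (rule coxeter_group_cases)
  show ?thesis
    using s
  proof (induction rule: sym_square_induct)
    case (sym_tensor v w)
    show ?case
      using t
    proof (induction rule: sym_square_induct)
      case (sym_tensor x y)
      then show ?case
        using u \<open>v \<in> V\<close> \<open>w \<in> V\<close>
        by (simp add: tensor_act_sym_tensor bform2_sym_tensor bform_word_act)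
    qed (simp add: tensor_act_diff bform2_diff_right)
  qed (simp add: tensor_act_diff bform2_diff_left)
qed

text \<open>For \<open>t = v \<or> w\<close> the operator \<open>1 - s\<^sub>\<gamma>\<close> produces multiples of \<open>\<gamma> \<or> v\<close>, \<open>\<gamma> \<or> w\<close> and \<open>\<gamma> \<or> \<gamma>\<close>. As
  \<open>s\<^sub>\<beta>\<close> fixes \<open>\<gamma>\<close>, applying \<open>1 - s\<^sub>\<beta>\<close> kills the last one and turns the first two into multiples of \<open>\<gamma> \<or> \<beta>\<close>.\<close>

lemma orthogonal_reflections:
  assumes \<beta>: "\<beta> \<in> real_roots I" and \<gamma>: "\<gamma> \<in> real_roots I" and orth: "B \<beta> \<gamma> = 0"
  obtains g h where "g \<in> carrier (coxeter_group I)" "h \<in> carrier (coxeter_group I)"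
    "\<And>t. t \<in> sym_square \<Longrightarrow>
      t - tact g t - tact h t + tact g (tact h t) = scale (bform2 I t (\<beta> \<or>\<^sub>s \<gamma>)) (\<beta> \<or>\<^sub>s \<gamma>)"
proof -
  obtain u where u: "u \<in> lists I" "\<And>v. act u v = v - scale (B \<beta> v) \<beta>"
    using reflection_word[OF \<beta>] by blast
  obtain u' where u': "u' \<in> lists I" "\<And>v. act u' v = v - scale (B \<gamma> v) \<gamma>"
    using reflection_word[OF \<gamma>] by blast
  have "t - tact (cls u) t - tact (cls u') t + tact (cls u) (tact (cls u') t)
      = scale (bform2 I t (\<beta> \<or>\<^sub>s \<gamma>)) (\<beta> \<or>\<^sub>s \<gamma>)" if "t \<in> sym_square" for t
    using that
  proof (induction rule: sym_square_induct)
    case (sym_tensor v w)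
    have orth': "B \<gamma> \<beta> = 0"
      using orth by (simp add: bform_commute)
    have "act u' v \<in> V" "act u' w \<in> V"
      using sym_tensor u'(1) by (simp_all add: word_act_in_V)
    then show ?case
      unfolding bform2_sym_tensor
      using sym_tensor u(1) u'(1)
      by (simp add: tensor_act_sym_tensor)
        (simp add: u(2) u'(2) bform_simps orth orth' bform_commute[of v] bform_commute[of w]
          pointwise sym_tensor_def tensor_def algebra_simps)
  next
    case (diff s t)
    have "s - t - tact (cls u) (s - t) - tact (cls u') (s - t) + tact (cls u) (tact (cls u') (s - t))
      = (s - tact (cls u) s - tact (cls u') s + tact (cls u) (tact (cls u') s))
        - (t - tact (cls u) t - tact (cls u') t + tact (cls u) (tact (cls u') t))"
      by (simp add: tensor_act_diff)
    also have "\<dots> = scale (bform2 I (s - t) (\<beta> \<or>\<^sub>s \<gamma>)) (\<beta> \<or>\<^sub>s \<gamma>)"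
      unfolding diff.IH by (simp add: bform2_diff_left pointwise algebra_simps)
    finally show ?case .
  qed
  then show ?thesis
    using that u(1) u'(1) coxeter_class_in_carrier by blast
qed

end

section \<open>The canonical basis under simple reflections\<close>

lemma adjacent_commute: "adjacent i j \<longleftrightarrow> adjacent j i"
  by (cases i; cases j) auto

lemma adjacent_irrefl: "\<not> adjacent i i"
  by (cases i) auto

lemma no_triangle: "adjacent i h \<Longrightarrow> adjacent i j \<Longrightarrow> \<not> adjacent h j"
  by (cases i; cases h; cases j) auto

lemma no_square: "adjacent i h \<Longrightarrow> adjacent i j \<Longrightarrow> h \<noteq> j \<Longrightarrow> adjacent k h \<Longrightarrow> adjacent k j \<Longrightarrow> k = i"
  by (cases i; cases h; cases j; cases k) (auto split: if_splits)

lemma trivalent: "adjacent i h \<Longrightarrow> adjacent i j \<Longrightarrow> adjacent i k \<Longrightarrow> h \<noteq> j \<Longrightarrow> h \<noteq> k \<Longrightarrow> j \<noteq> k \<Longrightarrow> i = Branch"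
  by (cases i; cases h; cases j; cases k) auto

lemma cartan_simps: "cartan i i = 2" "adjacent i j \<Longrightarrow> cartan i j = - 1"
  "i \<noteq> j \<Longrightarrow> \<not> adjacent i j \<Longrightarrow> cartan i j = 0"
  by (auto simp: cartan_def adjacent_irrefl)

lemma cartan_eq_0_iff: "cartan i j = 0 \<longleftrightarrow> i \<noteq> j \<and> \<not> adjacent i j"
  by (simp add: cartan_def)

lemma UNIV_arm: "(UNIV :: arm set) = {First, Second, Third}"
  using arm.exhaust by auto

text \<open>The neighbour on the side of the branch vertex.\<close>

fun inward :: "vertex \<Rightarrow> vertex" where
  "inward Branch = Branch"
| "inward (Arm x 0) = Branch"
| "inward (Arm x (Suc m)) = Arm x m"

text \<open>The highest root of the subsystem of type \<open>D\<close> whose diagram runs from \<open>Arm x m\<close> to the neighbours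
  of the branch vertex; see \<open>theta_eq\<close>.\<close>

definition D_root :: "arm \<Rightarrow> nat \<Rightarrow> vertex \<Rightarrow> real" where
  "D_root x m = (\<lambda>v. case v of Branch \<Rightarrow> 2
    | Arm y p \<Rightarrow> if y = x then (if p < m then 2 else if p = m then 1 else 0) else if p = 0 then 1 else 0)"

lemma D_root_simps [simp]:
  "D_root x m Branch = 2"
  "D_root x m (Arm y p) = (if y = x then (if p < m then 2 else if p = m then 1 else 0) else if p = 0 then 1 else 0)"
  by (simp_all add: D_root_def)

locale Y_type =
  fixes a b c :: nat
  assumes pos: "1 \<le> a" "1 \<le> b" "1 \<le> c"
begin

abbreviation I where "I \<equiv> Y_diagram a b c"

sublocale diagram "Y_diagram a b c"
  by unfold_locales (rule finite_Y_diagram)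

lemma Branch_in_I: "Branch \<in> I"
  by (simp add: Y_diagram_def)

lemma Arm_in_I_iff: "Arm x m \<in> I \<longleftrightarrow> m < arm_size a b c x"
  by (simp add: Y_diagram_def)

lemma Arm_0_in_I: "Arm x 0 \<in> I"
  using pos by (cases x) (simp_all add: Arm_in_I_iff)

lemma bform_Branch:
  "B (\<alpha> Branch) v = 2 * v Branch - v (Arm First 0) - v (Arm Second 0) - v (Arm Third 0)"
proof -
  let ?N = "{Branch, Arm First 0, Arm Second 0, Arm Third 0}"
  have "B (\<alpha> Branch) v = (\<Sum>j\<in>I. v j * of_int (cartan Branch j))"
    by (rule bform_simple_left[OF finite_I Branch_in_I])
  also have "\<dots> = (\<Sum>j\<in>?N. v j * of_int (cartan Branch j))"
  proof (rule sum.mono_neutral_right[OF finite_I])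
    show "?N \<subseteq> I"
      using Branch_in_I Arm_0_in_I by blast
    have "cartan Branch j = 0" if "j \<notin> ?N" for j
    proof (cases j)
      case (Arm x m)
      then show ?thesis
        using that by (cases x) (auto simp: cartan_def)
    qed (use that in simp)
    then show "\<forall>j\<in>I - ?N. v j * of_int (cartan Branch j) = 0"
      by auto
  qed
  finally show ?thesis
    by (simp add: cartan_def)
qed

lemma bform_Arm:
  assumes "Arm x m \<in> I" "v \<in> V"
  shows "B (\<alpha> (Arm x m)) v = 2 * v (Arm x m) - v (inward (Arm x m)) - v (Arm x (Suc m))"
proof -
  let ?N = "{Arm x m, inward (Arm x m), Arm x (Suc m)}"
  have zero: "cartan (Arm x m) j = 0" if "j \<notin> ?N" for j
    using that by (cases j; cases m) (auto simp: cartan_def)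
  have "B (\<alpha> (Arm x m)) v = (\<Sum>j\<in>I. v j * of_int (cartan (Arm x m) j))"
    by (rule bform_simple_left[OF finite_I assms(1)])
  also have "\<dots> = (\<Sum>j\<in>I \<union> ?N. v j * of_int (cartan (Arm x m) j))"
    using assms(2) finite_I by (intro sum.mono_neutral_left) (auto simp: V_def)
  also have "\<dots> = (\<Sum>j\<in>?N. v j * of_int (cartan (Arm x m) j))"
    using zero finite_I by (intro sum.mono_neutral_right) auto
  finally show ?thesis
    by (cases m) (simp_all add: cartan_def)
qed

text \<open>In the subdiagram the branch vertex has three neighbours and the inner vertices of the arm have
  two; the remaining vertices, which get the coefficient \<open>1\<close>, have one.\<close>

lemma theta_eq:
  assumes "Arm x m \<in> I"
  shows "theta I (Arm x m) = D_root x m"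
proof
  fix j
  let ?D = "D_subdiagram I (Arm x m)"
  have D: "?D = insert Branch (Arm x ` {..m} \<union> {Arm y 0 | y. True})"
  proof -
    have "{j \<in> I. adjacent Branch j} = {Arm y 0 | y. True}"
      using Arm_0_in_I by (auto elim: adjacent.elims)
    then show ?thesis
      by (simp add: D_subdiagram_def)
  qed
  have finD: "finite ?D"
    unfolding D by (simp add: full_SetCompr_eq UNIV_arm)
  have card: "(if card {h \<in> ?D. adjacent h j} = 1 then 1 else 2) = D_root x m j" if j: "j \<in> ?D"
  proof -
    consider "j = Branch" | p where "j = Arm x p" "p < m" | "j = Arm x m" | y where "j = Arm y 0" "y \<noteq> x"
      using j unfolding D by fastforce
    then show ?thesis
    proof cases
      case 1
      have "{h \<in> ?D. adjacent h j} = {Arm First 0, Arm Second 0, Arm Third 0}"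
        unfolding D 1 using arm.exhaust by (auto elim!: adjacent.elims)
      then show ?thesis
        using 1 by simp
    next
      case (2 p)
      have "{h \<in> ?D. adjacent h j} = {inward (Arm x p), Arm x (Suc p)}"
        unfolding D 2 using 2(2) by (cases p) (auto elim!: adjacent.elims)
      then show ?thesis
        using 2 by (cases p) auto
    next
      case 3
      have "{h \<in> ?D. adjacent h j} = {inward (Arm x m)}"
        unfolding D 3 by (cases m) (auto elim!: adjacent.elims)
      then show ?thesis
        using 3 by simp
    next
      case (4 y)
      have "{h \<in> ?D. adjacent h j} = {Branch}"
        unfolding D 4 using 4(2) by (auto elim!: adjacent.elims)
      then show ?thesis
        using 4 by simp
    qed
  qed
  have "theta I (Arm x m) j
      = (\<Sum>i\<in>?D. if i = j then (if card {h \<in> ?D. adjacent h i} = 1 then 1 else 2) else 0)"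
    unfolding theta_def sum_fun_apply
    by (rule sum.cong) (auto simp: simple_root_def scale_apply)
  also have "\<dots> = (if j \<in> ?D then D_root x m j else 0)"
    using card finD by simp
  also have "\<dots> = D_root x m j"
    unfolding D by (cases j) auto
  finally show "theta I (Arm x m) j = D_root x m j" .
qed

text \<open>The condition in \<open>elementary\<close> without positivity. Since \<open>shape i \<beta>\<close> already implies that \<open>\<beta>\<close> has
  nonnegative coordinates, elementary roots are the real roots of such a shape, and being a real root
  is inherited along the action of \<open>W\<close>.\<close>

definition shape :: "vertex \<Rightarrow> (vertex \<Rightarrow> real) \<Rightarrow> bool" where
  "shape i \<beta> \<longleftrightarrow>
    (\<exists>j\<in>I. cartan i j = 0 \<and> \<beta> = \<alpha> j)
     \<or> (\<exists>h\<in>I. \<exists>j\<in>I. h \<noteq> j \<and> adjacent h i \<and> adjacent i j \<and> \<beta> = \<alpha> h + \<alpha> i + \<alpha> j)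
     \<or> (\<exists>x m. i = Arm x m \<and> \<beta> = D_root x m)"

lemma elementary_iff:
  assumes "i \<in> I"
  shows "elementary I i \<beta> \<longleftrightarrow> \<beta> \<in> real_roots I \<and> shape i \<beta>"
proof -
  have "(i \<noteq> Branch \<and> \<beta> = theta I i) \<longleftrightarrow> (\<exists>x m. i = Arm x m \<and> \<beta> = D_root x m)"
    using theta_eq assms by (cases i) auto
  moreover have "0 \<le> \<beta> x" if "shape i \<beta>" for x
    using that unfolding shape_def by (cases x) (auto simp: simple_root_def plus_fun_apply)
  ultimately show ?thesis
    unfolding elementary_def shape_def positive_roots_def by blast
qed

lemma D_root_in_V: "Arm x m \<in> I \<Longrightarrow> D_root x m \<in> V"
  using Arm_0_in_I Branch_in_I unfolding V_def
  by (auto simp: D_root_def Arm_in_I_iff split: vertex.split)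

lemma bform_D_root:
  assumes "Arm x m \<in> I" "k \<in> I"
  shows "B (\<alpha> k) (D_root x m) = (if k = Arm x m then 0 else if k = inward (Arm x m) then 1
    else if k = Arm x (Suc m) \<or> (\<exists>y. y \<noteq> x \<and> k = Arm y 1) then - 1 else 0)"
proof (cases k)
  case Branch
  then show ?thesis
    by (cases x; cases m) (simp_all add: bform_Branch)
next
  case (Arm y p)
  then show ?thesis
    using assms by (cases p; cases m) (auto simp: bform_Arm D_root_in_V)
qed

lemma bform_elementary:
  assumes "i \<in> I" "shape i \<beta>"
  shows "B (\<alpha> i) \<beta> = 0"
  using assms unfolding shape_def
  by (auto simp: bform_add_right bform_simple[OF finite_I] cartan_simps adjacent_commute bform_D_root)

lemma shape_cases [consumes 1, case_names orthogonal path D]: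
  assumes "shape i \<beta>"
  obtains j where "j \<in> I" "i \<noteq> j" "\<not> adjacent i j" "\<beta> = \<alpha> j"
  | h j where "h \<in> I" "j \<in> I" "h \<noteq> j" "adjacent i h" "adjacent i j" "\<beta> = \<alpha> h + \<alpha> i + \<alpha> j"
  | x m where "i = Arm x m" "\<beta> = D_root x m"
  using assms unfolding shape_def cartan_eq_0_iff by (metis adjacent_commute)

lemma adjacent_Arm_iff: "adjacent k (Arm x m) \<longleftrightarrow> k = inward (Arm x m) \<or> k = Arm x (Suc m)"
  by (cases k; cases m) auto

text \<open>When \<open>\<beta>\<close> is the sum of the simple roots on a path with middle vertex
  \<open>i\<close>: in a tree, \<open>k \<noteq> i\<close> is adjacent to at most one of two distinct neighbours of \<open>i\<close>, so the value \<open>-2\<close> does not occur.\<close>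

lemma shape_step_nonadjacent:
  assumes i: "i \<in> I" and k: "k \<in> I" "k \<noteq> i" "\<not> adjacent k i" and s: "shape i \<beta>"
  shows "\<beta> = \<alpha> k \<or> B (\<alpha> k) \<beta> = 0 \<or> B (\<alpha> k) \<beta> = - 1"
  using s
proof (cases rule: shape_cases)
  case (orthogonal j)
  then show ?thesis
    using k by (auto simp: bform_simple[OF finite_I] cartan_def)
next
  case (path h j)
  have "k \<noteq> h" "k \<noteq> j"
    using path k by (auto simp: adjacent_commute)
  moreover have "\<not> (adjacent k h \<and> adjacent k j)"
    using no_square[OF path(4,5,3)] k by blast
  ultimately show ?thesis
    using path i k by (auto simp: bform_add_right bform_simple[OF finite_I] cartan_def)
next
  case (D x m)
  then show ?thesis
    using i k by (auto simp: bform_D_root adjacent_Arm_iff)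
qed

text \<open>For \<open>k\<close> adjacent to \<open>i\<close>, expanding \<open>s\<^sub>k (\<alpha>\<^sub>i \<or> \<beta>)\<close> gives
  \<open>\<alpha>\<^sub>i \<or> \<beta> + \<alpha>\<^sub>k \<or> \<gamma>\<close> with the vector \<open>\<gamma>\<close> of this lemma. The three shapes are
  closed under this step: two orthogonal simple roots
  give a path when \<open>k\<close> joins them, a path at the branch vertex gives \<open>\<theta>\<^sub>k\<close> when \<open>k\<close> is the third neighbour,
  and moving along an arm turns \<open>\<theta>\<^sub>i\<close> into \<open>\<theta>\<^sub>k\<close>.\<close>

lemma shape_step_adjacent:
  assumes i: "i \<in> I" and k: "k \<in> I" "adjacent k i" and s: "shape i \<beta>"
  shows "shape k (\<beta> - scale (B (\<alpha> k) \<beta>) (\<alpha> i + \<alpha> k))"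
  using s
proof (cases rule: shape_cases)
  case (orthogonal j)
  have "k \<noteq> j"
    using orthogonal k by (auto simp: adjacent_commute)
  show ?thesis
  proof (cases "adjacent k j")
    case True
    then have "B (\<alpha> k) \<beta> = - 1"
      using orthogonal k by (simp add: bform_simple[OF finite_I] cartan_simps)
    then have eq: "\<beta> - scale (B (\<alpha> k) \<beta>) (\<alpha> i + \<alpha> k) = \<alpha> i + \<alpha> k + \<alpha> j"
      by (simp add: pointwise orthogonal(4))
    show ?thesis
      unfolding eq shape_def using orthogonal i k True by (auto simp: adjacent_commute)
  next
    case False
    then have "B (\<alpha> k) \<beta> = 0"
      using orthogonal k \<open>k \<noteq> j\<close> by (simp add: bform_simple[OF finite_I] cartan_simps)
    then have eq: "\<beta> - scale (B (\<alpha> k) \<beta>) (\<alpha> i + \<alpha> k) = \<alpha> j"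
      by (simp add: pointwise orthogonal(4))
    show ?thesis
      unfolding eq shape_def using orthogonal False \<open>k \<noteq> j\<close> by (auto simp: cartan_eq_0_iff)
  qed
next
  case (path h j)
  have ik: "i \<noteq> k"
    using k by (auto simp: adjacent_irrefl)
  have tri: "\<not> adjacent h j" "\<not> adjacent j h"
    using no_triangle path by blast+
  have B: "B (\<alpha> k) \<beta> = of_int (cartan k h) - 1 + of_int (cartan k j)"
    using path i k by (simp add: bform_add_right bform_simple[OF finite_I] cartan_simps)
  consider "k = h" | "k = j" | "k \<noteq> h" "k \<noteq> j"
    by blast
  then show ?thesis
  proof cases
    case 1
    then have "B (\<alpha> k) \<beta> = 1"
      unfolding B using path(3) tri by (simp add: cartan_simps)
    then have eq: "\<beta> - scale (B (\<alpha> k) \<beta>) (\<alpha> i + \<alpha> k) = \<alpha> j"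
      using 1 by (simp add: pointwise path(6))
    show ?thesis
      unfolding eq shape_def using 1 path tri by (auto simp: cartan_eq_0_iff)
  next
    case 2
    then have "B (\<alpha> k) \<beta> = 1"
      unfolding B using path(3) tri by (simp add: cartan_simps)
    then have eq: "\<beta> - scale (B (\<alpha> k) \<beta>) (\<alpha> i + \<alpha> k) = \<alpha> h"
      using 2 by (simp add: pointwise path(6))
    show ?thesis
      unfolding eq shape_def using 2 path tri by (auto simp: cartan_eq_0_iff)
  next
    case 3
    have "adjacent i k"
      using k by (simp add: adjacent_commute)
    then have iB: "i = Branch" and nk: "\<not> adjacent k h" "\<not> adjacent k j"
      using trivalent[of i h j k] path 3 no_triangle by blast+
    obtain x y z where xyz: "h = Arm x 0" "j = Arm y 0" "k = Arm z 0"
      using path \<open>adjacent i k\<close> unfolding iB by (auto elim!: adjacent.elims)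
    have "B (\<alpha> k) \<beta> = - 1"
      unfolding B using 3 nk by (simp add: cartan_simps)
    then have "\<beta> - scale (B (\<alpha> k) \<beta>) (\<alpha> i + \<alpha> k) = \<alpha> h + \<alpha> i + \<alpha> j + \<alpha> i + \<alpha> k"
      by (simp add: pointwise path(6))
    also have "\<dots> = D_root z 0"
    proof
      fix v
      have "w = x \<or> w = y \<or> w = z" for w
        using path(3) 3 unfolding xyz by (cases w; cases x; cases y; cases z) auto
      then show "(\<alpha> h + \<alpha> i + \<alpha> j + \<alpha> i + \<alpha> k) v = D_root z 0 v"
        using path(3) 3 unfolding xyz iB
        by (cases v) (auto simp: simple_root_def plus_fun_apply)
    qed
    finally have eq: "\<beta> - scale (B (\<alpha> k) \<beta>) (\<alpha> i + \<alpha> k) = D_root z 0" .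
    show ?thesis
      unfolding eq shape_def using xyz by blast
  qed
next
  case (D x m)
  consider "k = Branch" "m = 0" | p where "k = Arm x p" "m = Suc p" | "k = Arm x (Suc m)"
    using k(2) unfolding D(1) adjacent_Arm_iff by (cases m) auto
  then show ?thesis
  proof cases
    case 1
    obtain y z where yz: "y \<noteq> z" "y \<noteq> x" "z \<noteq> x"
      by (cases x) auto
    then have all: "w = x \<or> w = y \<or> w = z" for w
      by (cases w; cases x; cases y; cases z) auto
    have Bk: "B (\<alpha> k) \<beta> = 1"
      using D i k 1 by (simp add: bform_D_root)
    have eq: "\<beta> - scale (B (\<alpha> k) \<beta>) (\<alpha> i + \<alpha> k) = \<alpha> (Arm y 0) + \<alpha> Branch + \<alpha> (Arm z 0)"
    proof
      fix v
      show "(\<beta> - scale (B (\<alpha> k) \<beta>) (\<alpha> i + \<alpha> k)) v = (\<alpha> (Arm y 0) + \<alpha> Branch + \<alpha> (Arm z 0)) v"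
      proof (cases v)
        case Branch
        then show ?thesis
          unfolding Bk unfolding D 1 by (simp add: pointwise simple_root_def)
      next
        case (Arm w p)
        then show ?thesis
          unfolding Bk unfolding D 1 using all[of w] yz
          by (auto simp: plus_fun_apply minus_apply scale_apply simple_root_def)
      qed
    qed
    show ?thesis
      unfolding eq shape_def using 1 yz Arm_0_in_I
      by (intro disjI2[OF disjI1] bexI[of _ "Arm y 0"] bexI[of _ "Arm z 0"]) simp_all
  next
    case (2 p)
    have Bk: "B (\<alpha> k) \<beta> = 1"
      using D i k 2 by (simp add: bform_D_root)
    have eq: "\<beta> - scale (B (\<alpha> k) \<beta>) (\<alpha> i + \<alpha> k) = D_root x p"
    proof
      show "(\<beta> - scale (B (\<alpha> k) \<beta>) (\<alpha> i + \<alpha> k)) v = D_root x p v" for v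
        unfolding Bk unfolding D 2
        by (cases v) (auto simp: plus_fun_apply minus_apply scale_apply simple_root_def)
    qed
    show ?thesis
      unfolding eq shape_def using 2 by blast
  next
    case 3
    have Bk: "B (\<alpha> k) \<beta> = - 1"
      using D i k 3 by (cases m) (auto simp: bform_D_root)
    have eq: "\<beta> - scale (B (\<alpha> k) \<beta>) (\<alpha> i + \<alpha> k) = D_root x (Suc m)"
    proof
      show "(\<beta> - scale (B (\<alpha> k) \<beta>) (\<alpha> i + \<alpha> k)) v = D_root x (Suc m) v" for v
        unfolding Bk unfolding D 3
        by (cases v) (auto simp: plus_fun_apply minus_apply scale_apply simple_root_def)
    qed
    show ?thesis
      unfolding eq shape_def using 3 by blast
  qed
qed

lemma canonical_basis_iff:
  "t \<in> canonical_basis I \<longleftrightarrow> (\<exists>i\<in>I. \<exists>\<beta>\<in>real_roots I. shape i \<beta> \<and> t = \<alpha> i \<or>\<^sub>s \<beta>)"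
proof -
  have "t \<in> canonical_basis I \<longleftrightarrow> (\<exists>i\<in>I. \<exists>\<beta>. elementary I i \<beta> \<and> t = \<alpha> i \<or>\<^sub>s \<beta>)"
    unfolding canonical_basis_def by auto
  also have "\<dots> \<longleftrightarrow> (\<exists>i\<in>I. \<exists>\<beta>\<in>real_roots I. shape i \<beta> \<and> t = \<alpha> i \<or>\<^sub>s \<beta>)"
    by (intro bex_cong refl) (auto simp: elementary_iff)
  finally show ?thesis .
qed

lemma canonical_basisE:
  assumes "t \<in> canonical_basis I"
  obtains i \<beta> where "i \<in> I" "\<beta> \<in> real_roots I" "shape i \<beta>" "t = \<alpha> i \<or>\<^sub>s \<beta>" "B (\<alpha> i) \<beta> = 0"
  using assms bform_elementary unfolding canonical_basis_iff by blast

text \<open>The correction term \<open>y = s\<^sub>k t - t\<close> lies in the orbit of \<open>t = \<alpha>\<^sub>i \<or> \<beta>\<close>: it is \<open>s\<^sub>i s\<^sub>k t\<close> if \<open>k\<close> is adjacent to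
  \<open>i\<close>, and \<open>s\<^sub>\<beta> s\<^sub>k t\<close> if \<open>\<alpha>\<^sub>k\<close> is orthogonal to \<open>\<alpha>\<^sub>i\<close> but not to \<open>\<beta>\<close>.\<close>

lemma simple_reflection_canonical_basis:
  assumes t: "t \<in> canonical_basis I" and k: "k \<in> I"
  shows "tact (cls [k]) t = t \<or> tact (cls [k]) t = - t \<or>
    (\<exists>y\<in>canonical_basis I. \<exists>g\<in>carrier (coxeter_group I). y = tact g t \<and> tact (cls [k]) t = t + y)"
proof -
  obtain i \<beta> where i: "i \<in> I" and \<beta>: "\<beta> \<in> real_roots I" "shape i \<beta>" and t_eq: "t = \<alpha> i \<or>\<^sub>s \<beta>"
    and orth: "B (\<alpha> i) \<beta> = 0"
    using t by (rule canonical_basisE)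
  have V: "\<alpha> i \<in> V" "\<beta> \<in> V" "\<alpha> k \<in> V"
    using i k \<beta> by (simp_all add: simple_root_in_V real_root_in_V)
  have sk: "act [k] v = v - scale (B (\<alpha> k) v) (\<alpha> k)" for v
    by (simp add: word_act_Cons word_act_Nil reflection_def)
  have kt: "tact (cls [k]) t = (\<alpha> i - scale (B (\<alpha> k) (\<alpha> i)) (\<alpha> k)) \<or>\<^sub>s (\<beta> - scale (B (\<alpha> k) \<beta>) (\<alpha> k))"
    unfolding t_eq sk[symmetric] using k V by (intro tensor_act_sym_tensor) auto
  have Bki: "B (\<alpha> k) (\<alpha> i) = of_int (cartan k i)"
    using i k by (simp add: bform_simple[OF finite_I])
  consider "k = i" | "adjacent k i" | "k \<noteq> i" "\<not> adjacent k i" "\<beta> = \<alpha> k"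
    | "k \<noteq> i" "\<not> adjacent k i" "B (\<alpha> k) \<beta> = 0" | "k \<noteq> i" "\<not> adjacent k i" "B (\<alpha> k) \<beta> = - 1"
    using shape_step_nonadjacent[OF i k _ _ \<beta>(2)] by blast
  then show ?thesis
  proof cases
    case 1
    then have "tact (cls [k]) t = - t"
      unfolding kt unfolding Bki t_eq using orth
      by (simp add: cartan_simps) (simp add: pointwise sym_tensor_def tensor_def)
    then show ?thesis by simp
  next
    case 2
    \<comment> \<open>\<open>s\<^sub>i s\<^sub>k\<close> maps \<open>\<alpha>\<^sub>i\<close> to \<open>\<alpha>\<^sub>k\<close> and \<open>\<beta>\<close> to \<open>\<gamma>\<close>\<close>
    define \<gamma> where "\<gamma> = \<beta> - scale (B (\<alpha> k) \<beta>) (\<alpha> i + \<alpha> k)"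
    have cart: "cartan k i = - 1" "cartan i k = - 1"
      using 2 by (simp_all add: cartan_simps adjacent_commute)
    have ik: "[i, k] \<in> lists I"
      using i k by simp
    have Bi: "B (\<alpha> i) (\<alpha> k) = - 1" "B (\<alpha> i) (\<alpha> i) = 2"
      using i k cart by (simp_all add: bform_simple[OF finite_I] cartan_simps)
    have act_ik: "act [i, k] v = v - scale (B (\<alpha> k) v) (\<alpha> k)
        - scale (B (\<alpha> i) v + B (\<alpha> k) v) (\<alpha> i)" for v
      by (simp add: word_act_Cons word_act_Nil reflection_def bform_simps Bi)
    have "act [i, k] (\<alpha> i) = \<alpha> k"
      unfolding act_ik Bki cart Bi by (simp add: pointwise)
    moreover have \<gamma>_act: "act [i, k] \<beta> = \<gamma>"
      unfolding act_ik orth \<gamma>_def by (simp add: pointwise algebra_simps)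
    ultimately have y: "tact (cls [i, k]) t = \<alpha> k \<or>\<^sub>s \<gamma>"
      unfolding t_eq using tensor_act_sym_tensor[OF ik V(1,2)] by simp
    have "\<gamma> \<in> real_roots I"
      using real_root_act[OF ik \<beta>(1)] by (simp add: \<gamma>_act)
    moreover have "shape k \<gamma>"
      unfolding \<gamma>_def by (rule shape_step_adjacent[OF i k 2 \<beta>(2)])
    ultimately have "\<alpha> k \<or>\<^sub>s \<gamma> \<in> canonical_basis I"
      unfolding canonical_basis_iff using k by blast
    moreover have "tact (cls [k]) t = t + (\<alpha> k \<or>\<^sub>s \<gamma>)"
      unfolding kt unfolding Bki cart t_eq \<gamma>_def
      by (simp add: pointwise sym_tensor_def tensor_def algebra_simps)
    ultimately show ?thesis
      using y coxeter_class_in_carrier[OF ik]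
      by (intro disjI2 bexI[of _ "\<alpha> k \<or>\<^sub>s \<gamma>"] bexI[of _ "cls [i, k]"]) simp_all
  next
    case 3
    have "B (\<alpha> k) \<beta> = 2"
      using 3 k by (simp add: bform_simple[OF finite_I] cartan_simps)
    then have "tact (cls [k]) t = - t"
      unfolding kt unfolding Bki t_eq using 3
      by (simp add: cartan_simps) (simp add: pointwise sym_tensor_def tensor_def)
    then show ?thesis by simp
  next
    case 4
    then have "tact (cls [k]) t = t"
      unfolding kt unfolding Bki t_eq by (simp add: cartan_simps pointwise sym_tensor_def tensor_def)
    then show ?thesis by simp
  next
    case 5
    \<comment> \<open>\<open>u\<close> represents \<open>s\<^sub>\<beta>\<close>, which fixes \<open>\<alpha>\<^sub>i\<close> and maps \<open>\<beta> + \<alpha>\<^sub>k\<close> to \<open>\<alpha>\<^sub>k\<close>\<close>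
    obtain u where u: "u \<in> lists I" "\<And>v. act u v = v - scale (B \<beta> v) \<beta>"
      using reflection_word[OF \<beta>(1)] by blast
    have cart: "cartan k i = 0" "cartan i k = 0"
      using 5 by (simp_all add: cartan_eq_0_iff adjacent_commute)
    have uk: "u @ [k] \<in> lists I"
      using u k by simp
    have B\<beta>: "B \<beta> (\<alpha> i) = 0" "B \<beta> (\<alpha> k) = - 1" "B \<beta> \<beta> = 2"
      using orth 5 real_root_norm[OF \<beta>(1)]
      by (simp_all add: bform_commute[of \<beta> "\<alpha> i"] bform_commute[of \<beta> "\<alpha> k"])
    have "act (u @ [k]) (\<alpha> i) = \<alpha> i"
      unfolding word_act_append sk Bki cart u(2) by (simp add: bform_simps B\<beta>) (simp add: pointwise)
    moreover have "act (u @ [k]) \<beta> = \<alpha> k"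
      unfolding word_act_append sk 5(3) u(2) by (simp add: bform_simps B\<beta>) (simp add: pointwise)
    ultimately have y: "tact (cls (u @ [k])) t = \<alpha> i \<or>\<^sub>s \<alpha> k"
      unfolding t_eq using tensor_act_sym_tensor[OF uk V(1,2)] by simp
    have "shape i (\<alpha> k)"
      unfolding shape_def using cart k by blast
    then have "\<alpha> i \<or>\<^sub>s \<alpha> k \<in> canonical_basis I"
      unfolding canonical_basis_iff using i k simple_root_real by blast
    moreover have "tact (cls [k]) t = t + (\<alpha> i \<or>\<^sub>s \<alpha> k)"
      unfolding kt unfolding Bki cart t_eq 5(3)
      by (simp add: pointwise sym_tensor_def tensor_def algebra_simps)
    ultimately show ?thesis
      using y coxeter_class_in_carrier[OF uk]
      by (intro disjI2 bexI[of _ "\<alpha> i \<or>\<^sub>s \<alpha> k"] bexI[of _ "cls (u @ [k])"]) simp_all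
  qed
qed

end

section \<open>The lattice spanned by the canonical 2-roots in an orbit\<close>

context Y_type
begin

abbreviation W where "W \<equiv> coxeter_group I"

lemma canonical_basis_in_sym_square: "canonical_basis I \<subseteq> sym_square"
proof
  fix t assume "t \<in> canonical_basis I"
  then obtain i \<beta> where "i \<in> I" "\<beta> \<in> real_roots I" "t = \<alpha> i \<or>\<^sub>s \<beta>"
    by (rule canonical_basisE)
  then show "t \<in> sym_square"
    by (simp add: sym_tensor_in_sym_square simple_root_in_V real_root_in_V)
qed

lemma real_2_roots_in_sym_square: "t \<in> real_2_roots I \<Longrightarrow> t \<in> sym_square"
  by (auto simp: real_2_roots_def intro!: sym_tensor_in_sym_square real_root_in_V)

context
  fixes X
  assumes X: "X \<in> orbits W (real_2_roots I) tact"
begin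

abbreviation S where "S \<equiv> canonical_basis I \<inter> X"
abbreviation L where "L \<equiv> group_closure S"

lemma S_subset: "S \<subseteq> sym_square"
  using canonical_basis_in_sym_square by blast

lemma L_subset: "t \<in> L \<Longrightarrow> t \<in> sym_square"
proof (induction rule: group_closure.induct)
  case (base s)
  then show ?case
  proof (cases "s = 0")
    case True
    then show ?thesis by (simp only: sym_square_def zero_in_group_closure)
  next
    case False
    then show ?thesis using base S_subset by blast
  qed
next
  case (diff s t)
  show ?case
    using diff.IH unfolding sym_square_def by (rule group_closure.diff)
qed

lemma orbit_closed:
  assumes "g \<in> carrier W" "t \<in> X"
  shows "tact g t \<in> X"
proof -
  interpret W: group W by (rule group_coxeter_group)
  obtain x where x: "x \<in> real_2_roots I" "X = {tact g x | g. g \<in> carrier W}"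
    using X by (auto simp: orbits_def orbit_def)
  obtain h where h: "h \<in> carrier W" "t = tact h x"
    using assms x by blast
  then have "tact g t = tact (g \<otimes>\<^bsub>W\<^esub> h) x"
    using assms x real_2_roots_in_sym_square by (simp add: tensor_act_mult)
  moreover have "g \<otimes>\<^bsub>W\<^esub> h \<in> carrier W"
    using assms(1) h by simp
  ultimately show ?thesis
    using x by blast
qed

lemma orbit_transitive:
  assumes "s \<in> X" "t \<in> X"
  shows "\<exists>g\<in>carrier W. tact g s = t"
proof -
  interpret W: group W by (rule group_coxeter_group)
  obtain x where x: "x \<in> real_2_roots I" "X = {tact g x | g. g \<in> carrier W}"
    using X by (auto simp: orbits_def orbit_def)
  have xS: "x \<in> sym_square"
    using x by (simp add: real_2_roots_in_sym_square)
  obtain g h where gh: "g \<in> carrier W" "s = tact g x" "h \<in> carrier W" "t = tact h x"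
    using assms x by blast
  have "tact (h \<otimes>\<^bsub>W\<^esub> inv\<^bsub>W\<^esub> g) s = tact (h \<otimes>\<^bsub>W\<^esub> inv\<^bsub>W\<^esub> g \<otimes>\<^bsub>W\<^esub> g) x"
    using gh xS by (simp add: tensor_act_mult)
  also have "h \<otimes>\<^bsub>W\<^esub> inv\<^bsub>W\<^esub> g \<otimes>\<^bsub>W\<^esub> g = h"
    using gh by (simp add: W.m_assoc)
  finally show ?thesis
    using gh by (intro bexI[of _ "h \<otimes>\<^bsub>W\<^esub> inv\<^bsub>W\<^esub> g"]) auto
qed

text \<open>This is where it matters that the correction term of \<open>simple_reflection_canonical_basis\<close> lies
  in the same orbit, not merely in the canonical basis.\<close>

lemma L_closed_simple:
  assumes k: "k \<in> I" and t: "t \<in> L"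
  shows "tact (cls [k]) t \<in> L"
  using t
proof (induction rule: group_closure.induct)
  case (base s)
  show ?case
  proof (cases "s = 0")
    case True
    then show ?thesis by (simp only: tensor_act_zero zero_in_group_closure)
  next
    case False
    then have s: "s \<in> canonical_basis I" "s \<in> X"
      using base by auto
    then have sL: "s \<in> L"
      by (intro group_closure.base) simp
    show ?thesis
      using simple_reflection_canonical_basis[OF s(1) k]
    proof (elim disjE bexE conjE)
      fix y g assume y: "y \<in> canonical_basis I" "g \<in> carrier W" "y = tact g s"
        "tact (cls [k]) s = s + y"
      then have "y \<in> L"
        using orbit_closed[OF y(2) s(2)] by (intro group_closure.base) simp
      then show ?thesis
        unfolding y(4) using sL by (rule group_closure_add[rotated])
    qed (use sL in \<open>simp_all only: group_closure_minus_iff\<close>)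
  qed
next
  case (diff s t)
  show ?case
    unfolding tensor_act_diff using diff.IH by (rule group_closure.diff)
qed

lemma L_closed_act:
  assumes g: "g \<in> carrier W" and t: "t \<in> L"
  shows "tact g t \<in> L"
proof -
  obtain u where u: "u \<in> lists I" "g = cls u"
    using g by (rule coxeter_group_cases)
  have "tact (cls u) t \<in> L" if "u \<in> lists I" for u
    using that
  proof (induction u)
    case Nil
    then show ?case
      using t tensor_act_one[OF L_subset[OF t]] by (simp add: coxeter_group_one)
  next
    case (Cons k u)
    then have k: "[k] \<in> lists I" "u \<in> lists I" "k \<in> I"
      by auto
    have "tact (cls (k # u)) t = tact (cls [k]) (tact (cls u) t)"
      using tensor_act_mult[OF coxeter_class_in_carrier[OF k(1)] coxeter_class_in_carrier[OF k(2)] L_subset[OF t]]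
      by (simp add: coxeter_mult_class[OF k(1,2)])
    then show ?case
      using L_closed_simple[OF k(3)] Cons.IH k(2) by simp
  qed
  then show ?thesis
    using u by simp
qed

lemma bform2_integral:
  assumes "s \<in> L" "t \<in> L"
  shows "bform2 I s t \<in> \<int>"
proof -
  have z: "bform2 I 0 u = 0" "bform2 I u 0 = 0" for u
    using bform2_add_left[of I 0 0 u] bform2_add_right[of I u 0 0] by simp_all
  show ?thesis
    using assms(1)
  proof (induction rule: group_closure.induct)
    case (base s)
    show ?case
      using assms(2)
    proof (induction rule: group_closure.induct)
      case (base t)
      show ?case
      proof (cases "s = 0 \<or> t = 0")
        case True
        then show ?thesis
          by (elim disjE) (simp_all only: z Ints_0)
      next
        case False
        then have "s \<in> canonical_basis I" "t \<in> canonical_basis I"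
          using base \<open>s \<in> insert 0 S\<close> by auto
        then show ?thesis
          by (elim canonical_basisE)
            (auto simp: bform2_sym_tensor intro!: Ints_add Ints_mult bform_real_roots_integral simple_root_real)
      qed
    qed (simp only: bform2_diff_right Ints_diff)
  qed (simp only: bform2_diff_left Ints_diff)
qed

lemma equivariant_lattice_canonical_basis:
  assumes "cring F"
  shows "equivariant_lattice F L (bform2 I) W tact"
proof -
  interpret W: group W by (rule group_coxeter_group)
  interpret F: cring F by (rule assms)
  show ?thesis
    by unfold_locales
      (auto simp: bform2_integral bform2_add_left bform2_add_right L_closed_act tensor_act_add
        tensor_act_mult tensor_act_one bform2_tensor_act L_subset intro: group_closure.diff)
qed

lemma rank_one_canonical_basis:
  assumes s: "s \<in> S"
  shows "\<exists>g\<in>carrier W. \<exists>h\<in>carrier W. \<exists>\<mu> :: int \<Rightarrow> vertex \<times> vertex \<Rightarrow> real.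
      (\<forall>i j. \<mu> (i + j) = \<mu> i + \<mu> j) \<and> \<mu> 1 = s \<and>
      (\<forall>x\<in>L. x - tact g x - tact h x + tact g (tact h x) = \<mu> \<lfloor>bform2 I x s\<rfloor>)"
proof -
  have "s \<in> canonical_basis I"
    using s by simp
  then obtain i \<beta> where s_eq: "i \<in> I" "\<beta> \<in> real_roots I" "s = \<alpha> i \<or>\<^sub>s \<beta>" "B (\<alpha> i) \<beta> = 0"
    by (rule canonical_basisE)
  obtain g h where gh: "g \<in> carrier W" "h \<in> carrier W"
    "\<And>t. t \<in> sym_square \<Longrightarrow> t - tact g t - tact h t + tact g (tact h t) = scale (bform2 I t s) s"
    using orthogonal_reflections[OF simple_root_real[OF s_eq(1)] s_eq(2,4)] unfolding s_eq(3) by blast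
  define \<mu> where "\<mu> n = scale (of_int n) s" for n :: int
  have "x - tact g x - tact h x + tact g (tact h x) = \<mu> \<lfloor>bform2 I x s\<rfloor>" if "x \<in> L" for x
  proof -
    have "s \<in> L"
      using s by (intro group_closure.base) simp
    then have floor: "of_int \<lfloor>bform2 I x s\<rfloor> = bform2 I x s"
      using bform2_integral[OF that] by (auto elim: Ints_cases)
    show ?thesis
      unfolding \<mu>_def floor by (rule gh(3)[OF L_subset[OF that]])
  qed
  moreover have "\<mu> (i + j) = \<mu> i + \<mu> j" "\<mu> 1 = s" for i j
    by (simp_all add: \<mu>_def pointwise distrib_right)
  ultimately show ?thesis
    using gh(1,2) by blast
qed

end

end

section \<open>Submodules of the span of an orbit\<close>

theorem theorem7p3:
  fixes a b c :: nat
    and F :: "('f, 'r) ring_scheme"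
    and X :: "(vertex \<times> vertex \<Rightarrow> real) set"
  defines "I \<equiv> Y_diagram a b c"
  defines "W \<equiv> coxeter_group I"
  defines "L \<equiv> group_closure (canonical_basis I \<inter> X)"
  defines "N \<equiv> base_change F L"
  defines "\<rho> \<equiv> base_change_act F L (tensor_act I)"
  defines "B' \<equiv> base_change_form F (bform2 I)"
  defines "R \<equiv> radical F N B'"
  assumes "1 \<le> a" "1 \<le> b" "1 \<le> c"
    and "X \<in> orbits W (real_2_roots I) (tensor_act I)"
    and "field F"
    and "\<exists>u\<in>carrier N. \<exists>v\<in>carrier N. B' u v \<noteq> \<zero>\<^bsub>F\<^esub>"
  shows "(\<forall>H. maximal_group_submodule F W N \<rho> H \<longleftrightarrow> H = R)
    \<and> irreducible_group_module F W (quotient_module N R) (quotient_act N R \<rho>)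
    \<and> indecomposable_group_module F W N \<rho>
    \<and> (irreducible_group_module F W N \<rho> \<longleftrightarrow> R = {\<zero>\<^bsub>N\<^esub>})"
proof -
  interpret Y: Y_type a b c
    by unfold_locales fact+
  have X: "X \<in> orbits (coxeter_group (Y_diagram a b c)) (real_2_roots (Y_diagram a b c))
      (tensor_act (Y_diagram a b c))"
    using assms(11) unfolding W_def I_def .
  interpret F: field F by fact
  interpret E: equivariant_lattice F L "bform2 I" W "tensor_act I"
    unfolding L_def W_def I_def
    by (rule Y.equivariant_lattice_canonical_basis[OF X F.is_cring])
  have sub: "group_submodule F W N \<rho> R"
    unfolding R_def B'_def N_def \<rho>_def by (rule E.I.group_submodule_radical)
  have proper: "R \<noteq> carrier N"
    using assms(13) unfolding R_def radical_def by blast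
  have largest: "K \<subseteq> R \<or> K = carrier N" if K: "group_submodule F W N \<rho> K" for K
    unfolding R_def B'_def N_def
  proof (rule E.radical_largest_proper_submodule)
    show "field F" by fact
    show "L = group_closure (canonical_basis I \<inter> X)"
      by (simp only: L_def)
    show "group_submodule F W (base_change F L) (base_change_act F L (tensor_act I)) K"
      using K unfolding N_def \<rho>_def .
    show "\<exists>g\<in>carrier W. tensor_act I g s = t"
      if "s \<in> canonical_basis I \<inter> X" "t \<in> canonical_basis I \<inter> X" for s t
      using that unfolding W_def I_def by (intro Y.orbit_transitive[OF X]) simp_all
    show "\<exists>g\<in>carrier W. \<exists>h\<in>carrier W. \<exists>\<mu> :: int \<Rightarrow> vertex \<times> vertex \<Rightarrow> real.
      (\<forall>i j. \<mu> (i + j) = \<mu> i + \<mu> j) \<and> \<mu> 1 = s \<and>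
      (\<forall>x\<in>L. x - tensor_act I g x - tensor_act I h x + tensor_act I g (tensor_act I h x)
        = \<mu> \<lfloor>bform2 I x s\<rfloor>)" if "s \<in> canonical_basis I \<inter> X" for s
      using that unfolding L_def W_def I_def by (rule Y.rank_one_canonical_basis[OF X])
  qed
  note concl = E.I.largest_proper_submodule[folded N_def \<rho>_def, OF sub proper largest]
  show ?thesis
    by (intro conjI allI concl)
qed

end
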